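(* Let $S$ and $\hat S$ be the transfer functions of the leader-follower network and of its reduced order network obtained by clustering according to a partition $\pi$ (all notation as in the context). Assume that the original network is synchronized and that $\pi=\{C_1,\dots,C_k\}$ is an almost equitable partition of the connected, weighted, undirected graph $\mathcal{G}$. For $i=1,\dots,m$ let $C_{k_i}$ be the cell of $\pi$ containing the leader $v_i$. Then $$\|S-\hat S\|_{\mathcal{H}_2}^2\le S_{\max,\mathcal{H}_2}^2\sum_{i=1}^m\left(1-\frac{1}{|C_{k_i}|}\right),\qquad S_{\max,\mathcal{H}_2}:=\max_{\lambda\in\sigma(L)\setminus\sigma(\hat L)}\|S_\lambda\|_{\mathcal{H}_2}.$$ Furthermore, whenever the denominators below are nonzero, $$\frac{\|S-\hat S\|_{\mathcal{H}_2}^2}{\|S\|_{\mathcal{H}_2}^2}\le\frac{S_{\max,\mathcal{H}_2}^2}{S_{\min,\mathcal{H}_2}^2}\cdot\frac{\sum_{i=1}^m\left(1-\frac{1}{|C_{k_i}|}\right)}{m\left(1-\frac1N\right)},\qquad S_{\min,\mathcal{H}_2}:=\min_{\lambda\in\sigma(L)\setminus\{0\}}\|S_\lambda\|_{\mathcal{H}_2}.$$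
   Context: Graph. $\mathcal{G}$ is a connected weighted undirected graph on $\mathcal{V}=\{1,\dots,N\}$ with symmetric adjacency matrix $(a_{ij})$, $a_{ij}\ge 0$, $a_{ii}=0$. Its Laplacian is $L\in\mathbb{R}^{N\times N}$ with $L_{ii}=\sum_{j}a_{ij}$ and $L_{ij}=-a_{ij}$ for $i\ne j$. The leaders are distinct nodes $v_1,\dots,v_m\in\mathcal{V}$; $M\in\mathbb{R}^{N\times m}$ has $M_{ij}=1$ if $i=v_j$ and $M_{ij}=0$ otherwise. Network. Let $A,B\in\mathbb{R}^{n\times n}$, $E\in\mathbb{R}^{n\times r}$. The network is $$\dot x=(I_N\otimes A-L\otimes B)x+(M\otimes E)u,\qquad y=(L\otimes I_n)x,$$ with $x=\mathrm{col}(x_1,\dots,x_N)$, $x_i\in\mathbb{R}^n$, and $u\in\mathbb{R}^{mr}$. Its transfer function is $S$. It is synchronized if for $u=0$ and every initial state, $x_i(t)-x_j(t)\to0$ as $t\to\infty$ for all $i,j$ (equivalently, $A-\lambda B$ is Hurwitz for every nonzero eigenvalue $\lambda$ of $L$). Partitions. A partition $\pi=\{C_1,\dots,C_k\}$ of $\mathcal{G}$ is a partition of $\mathcal{V}$ into nonempty pairwise disjoint cells. Its characteristic matrix $P\in\mathbb{R}^{N\times k}$ has $P_{ij}=1$ if $i\in C_j$ and $0$ otherwise. $\pi$ is almost equitable if for all $p\neq q$ the number $d_{pq}(j)=\sum_{i\in C_p}a_{ij}$ is the same for all $j\in C_q$. Reduced network. With $\hat L=(P^TP)^{-1}P^TLP$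 and $\hat M=(P^TP)^{-1}P^TM$, the reduced network is $$\dot{\hat x}=(I_k\otimes A-\hat L\otimes B)\hat x+(\hat M\otimes E)u,\qquad \hat y=(LP\otimes I_n)\hat x,$$ with transfer function $\hat S$. Auxiliary systems. For a nonzero eigenvalue $\lambda$ of $L$, $S_\lambda(s)=\lambda(sI-A+\lambda B)^{-1}E$. Spectra. For an almost equitable partition, $\sigma(\hat L)\subseteq\sigma(L)$. The difference $\sigma(L)\setminus\sigma(\hat L)$ is counted with multiplicities: if the eigenvalues of $L$ are listed with multiplicity as $0,\lambda_2,\dots,\lambda_N$ so that $0,\lambda_2,\dots,\lambda_k$ are the eigenvalues of $\hat L$ with multiplicity, then $\sigma(L)\setminus\sigma(\hat L)=\{\lambda_{k+1},\dots,\lambda_N\}$. A maximum over the empty set (case $k=N$) is taken to be $0$. Norm. For a transfer function $G$ with all poles (as a rational matrix) in the open left half plane, $\|G\|_{\mathcal{H}_2}^2=\frac1{2\pi}\int_{-\infty}^{\infty}\mathrm{tr}\left(G(-i\omega)^TG(i\omega)\right)d\omega$. *)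

theory Defs
  imports
    "HOL-Analysis.Analysis"
    "HOL-Complex_Analysis.Complex_Analysis"
    "HOL-Computational_Algebra.Polynomial"
    "HOL-Library.Disjoint_Sets"
begin

(* Dimensions are finite index types: 'v nodes, 'k cells, 'm leaders, 'n agent states,
   'r agent inputs. A p x q matrix has type real^'q^'p. Stacked vectors and Kronecker
   products are indexed by pairs, so that x $ (i, s) is the s-th entry of the block x_i. *)

definition kron ::
  "'a::times ^ 'q::finite ^ 'p::finite \<Rightarrow> 'a ^ 's::finite ^ 't::finite \<Rightarrow> 'a ^ ('q \<times> 's) ^ ('p \<times> 't)"
  where "kron X Y = (\<chi> i j. X $ fst i $ fst j * Y $ snd i $ snd j)"

definition block :: "real ^ ('v::finite \<times> 'n::finite) \<Rightarrow> 'v \<Rightarrow> real ^ 'n"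
  where "block x i = (\<chi> s. x $ (i, s))"


subsection \<open>Graphs and partitions\<close>

definition weighted_graph :: "real ^ 'v::finite ^ 'v \<Rightarrow> bool"
  where "weighted_graph a \<longleftrightarrow>
    (\<forall>i j. a $ i $ j = a $ j $ i) \<and> (\<forall>i j. 0 \<le> a $ i $ j) \<and> (\<forall>i. a $ i $ i = 0)"

definition graph_connected :: "real ^ 'v::finite ^ 'v \<Rightarrow> bool"
  where "graph_connected a \<longleftrightarrow> (\<forall>i j. (i, j) \<in> {(p, q). a $ p $ q > 0}\<^sup>*)"

definition laplacian :: "real ^ 'v::finite ^ 'v \<Rightarrow> real ^ 'v ^ 'v"
  where "laplacian a = (\<chi> i j. if i = j then (\<Sum>l\<in>UNIV. a $ i $ l) else - (a $ i $ j))"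

definition leader_matrix :: "('m::finite \<Rightarrow> 'v::finite) \<Rightarrow> real ^ 'm ^ 'v"
  where "leader_matrix v = (\<chi> i j. if i = v j then 1 else 0)"

definition graph_partition :: "('k::finite \<Rightarrow> 'v::finite set) \<Rightarrow> bool"
  where "graph_partition C \<longleftrightarrow>
    (\<forall>p. C p \<noteq> {}) \<and> disjoint_family C \<and> (\<Union>p. C p) = UNIV"

definition char_matrix :: "('k::finite \<Rightarrow> 'v::finite set) \<Rightarrow> real ^ 'k ^ 'v"
  where "char_matrix C = (\<chi> i j. if i \<in> C j then 1 else 0)"

definition almost_equitable :: "real ^ 'v::finite ^ 'v \<Rightarrow> ('k::finite \<Rightarrow> 'v set) \<Rightarrow> bool"
  where "almost_equitable a C \<longleftrightarrow>
    (\<forall>p q. p \<noteq> q \<longrightarrow> (\<forall>j\<in>C q. \<forall>j'\<in>C q. (\<Sum>i\<in>C p. a $ i $ j) = (\<Sum>i\<in>C p. a $ i $ j')))"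

definition red_laplacian :: "real ^ 'v::finite ^ 'v \<Rightarrow> ('k::finite \<Rightarrow> 'v set) \<Rightarrow> real ^ 'k ^ 'k"
  where "red_laplacian a C = (let P = char_matrix C in
    matrix_inv (transpose P ** P) ** transpose P ** laplacian a ** P)"

definition red_leader_matrix ::
  "('m::finite \<Rightarrow> 'v::finite) \<Rightarrow> ('k::finite \<Rightarrow> 'v set) \<Rightarrow> real ^ 'm ^ 'k"
  where "red_leader_matrix v C = (let P = char_matrix C in
    matrix_inv (transpose P ** P) ** transpose P ** leader_matrix v)"


subsection \<open>Spectra\<close>

definition charpoly :: "real ^ 'a::finite ^ 'a \<Rightarrow> real poly"
  where "charpoly X = det (\<chi> i j. (if i = j then [:0, 1:] else 0) - [:X $ i $ j:])"

(* Eigenvalues with algebraic multiplicity. Real roots suffice: the matrices below are the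
   symmetric Laplacian and the reduced Laplacian, which is similar to a symmetric matrix. *)
definition spectrum :: "real ^ 'a::finite ^ 'a \<Rightarrow> real multiset"
  where "spectrum X = proots (charpoly X)"


subsection \<open>Linear systems, transfer functions and the H2 norm\<close>

definition cmat :: "real ^ 'q::finite ^ 'p::finite \<Rightarrow> complex ^ 'q ^ 'p"
  where "cmat X = map_matrix complex_of_real X"

(* Transfer function of x' = F x + G u, y = H x. At the eigenvalues of F the value is an
   arbitrary one; these finitely many points affect neither the poles (which are limits over
   punctured neighbourhoods) nor the integral below. *)
definition transfer_function ::
  "real ^ 'x::finite ^ 'x \<Rightarrow> real ^ 'u::finite ^ 'x \<Rightarrow> real ^ 'x ^ 'y::finite
    \<Rightarrow> complex \<Rightarrow> complex ^ 'u ^ 'y"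
  where "transfer_function F G H s = cmat H ** matrix_inv (mat s - cmat F) ** cmat G"

definition stable_poles :: "(complex \<Rightarrow> complex ^ 'u::finite ^ 'y::finite) \<Rightarrow> bool"
  where "stable_poles G \<longleftrightarrow> (\<forall>i j s. is_pole (\<lambda>z. G z $ i $ j) s \<longrightarrow> Re s < 0)"

(* For real rational G the trace is the sum of |G_ij(i w)|^2, so Re discards nothing.
   The norm is unspecified if G has a pole outside the open left half plane. *)
definition h2_norm :: "(complex \<Rightarrow> complex ^ 'u::finite ^ 'y::finite) \<Rightarrow> real"
  where "h2_norm G =
    (if stable_poles G
     then sqrt (1 / (2 * pi) *
       Re (LINT \<omega>|lborel.
         trace (transpose (G (- (\<i> * complex_of_real \<omega>))) ** G (\<i> * complex_of_real \<omega>))))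
     else undefined)"


subsection \<open>The network, its reduction and the auxiliary systems\<close>

definition network_matrix ::
  "real ^ 'w::finite ^ 'w \<Rightarrow> real ^ 'n::finite ^ 'n \<Rightarrow> real ^ 'n ^ 'n \<Rightarrow> real ^ ('w \<times> 'n) ^ ('w \<times> 'n)"
  where "network_matrix L A B = kron (mat 1) A - kron L B"

definition synchronized ::
  "real ^ 'v::finite ^ 'v \<Rightarrow> real ^ 'n::finite ^ 'n \<Rightarrow> real ^ 'n ^ 'n \<Rightarrow> bool"
  where "synchronized a A B \<longleftrightarrow>
    (\<forall>x :: real \<Rightarrow> real ^ ('v \<times> 'n).
      (\<forall>t\<ge>0. (x has_vector_derivative network_matrix (laplacian a) A B *v x t) (at t within {0..}))
      \<longrightarrow> (\<forall>i j. ((\<lambda>t. block (x t) i - block (x t) j) \<longlongrightarrow> 0) at_top))"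

definition network_tf ::
  "real ^ 'v::finite ^ 'v \<Rightarrow> ('m::finite \<Rightarrow> 'v) \<Rightarrow> real ^ 'n::finite ^ 'n \<Rightarrow> real ^ 'n ^ 'n
    \<Rightarrow> real ^ 'r::finite ^ 'n \<Rightarrow> complex \<Rightarrow> complex ^ ('m \<times> 'r) ^ ('v \<times> 'n)"
  where "network_tf a v A B E = transfer_function
    (network_matrix (laplacian a) A B) (kron (leader_matrix v) E) (kron (laplacian a) (mat 1))"

definition reduced_tf ::
  "real ^ 'v::finite ^ 'v \<Rightarrow> ('m::finite \<Rightarrow> 'v) \<Rightarrow> ('k::finite \<Rightarrow> 'v set)
    \<Rightarrow> real ^ 'n::finite ^ 'n \<Rightarrow> real ^ 'n ^ 'n
    \<Rightarrow> real ^ 'r::finite ^ 'n \<Rightarrow> complex \<Rightarrow> complex ^ ('m \<times> 'r) ^ ('v \<times> 'n)"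
  where "reduced_tf a v C A B E = transfer_function
    (network_matrix (red_laplacian a C) A B) (kron (red_leader_matrix v C) E)
    (kron (laplacian a ** char_matrix C) (mat 1))"

definition aux_tf ::
  "real ^ 'n::finite ^ 'n \<Rightarrow> real ^ 'n ^ 'n \<Rightarrow> real ^ 'r::finite ^ 'n \<Rightarrow> real
    \<Rightarrow> complex \<Rightarrow> complex ^ 'r ^ 'n"
  where "aux_tf A B E l = transfer_function (A - l *\<^sub>R B) E (mat l)"

definition S_max ::
  "real ^ 'v::finite ^ 'v \<Rightarrow> ('k::finite \<Rightarrow> 'v set) \<Rightarrow> real ^ 'n::finite ^ 'n \<Rightarrow> real ^ 'n ^ 'n
    \<Rightarrow> real ^ 'r::finite ^ 'n \<Rightarrow> real"
  where "S_max a C A B E =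
    (let D = set_mset (spectrum (laplacian a) - spectrum (red_laplacian a C))
     in if D = {} then 0 else Max ((\<lambda>l. h2_norm (aux_tf A B E l)) ` D))"

(* The minimum ranges over the empty set only if there is a single node. *)
definition S_min ::
  "real ^ 'v::finite ^ 'v \<Rightarrow> real ^ 'n::finite ^ 'n \<Rightarrow> real ^ 'n ^ 'n
    \<Rightarrow> real ^ 'r::finite ^ 'n \<Rightarrow> real"
  where "S_min a A B E =
    Min ((\<lambda>l. h2_norm (aux_tf A B E l)) ` (set_mset (spectrum (laplacian a)) - {0}))"

end

theory Submission
  imports Defs "HOL-Probability.Sinc_Integral"
begin

text \<open>
  The Laplacian \<open>L\<close> is symmetric, so it has an orthonormal eigenbasis \<open>U\<close>, and the network decouples
  along it: its transfer function is the sum over \<open>u\<close> in \<open>U\<close> of \<open>(u u\<^sup>T M) \<otimes> S\<^sub>\<lambda>\<close>, where \<open>\<lambda>\<close> is the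
  eigenvalue of \<open>u\<close> and \<open>S\<^sub>\<lambda>\<close> the auxiliary system. The matrices \<open>u u\<^sup>T M\<close> are orthogonal for the
  trace inner product, so the squared H2 norms add up with the weights \<open>|u\<^sup>T M|\<^sup>2\<close>
  (\<open>network_h2_norm\<close>). The mode of the eigenvalue 0 drops out, because the output matrix contains \<open>L\<close>;
  the others are stable because the network is synchronized (\<open>synchronized_imp_hurwitz\<close>).

  For an almost equitable partition, the space of vectors that are constant on cells, which is the
  range of the characteristic matrix \<open>P\<close>, is invariant under \<open>L\<close>; more precisely \<open>L P\<close> equals \<open>P\<close> times
  the reduced Laplacian (\<open>almost_equitable_quotient\<close>). Consequently the reduced network is the
  original one with the input matrix \<open>M\<close> replaced by its orthogonal projection \<open>P Mh\<close> onto that space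
  (\<open>reduced_transfer_function\<close>), where \<open>Mh\<close> is the reduced input matrix. The reduction error is the
  network with input matrix \<open>M - P Mh\<close>. Choose the eigenbasis adapted to the invariant space, as a union
  of a basis \<open>B1\<close> of the space and a basis \<open>B2\<close> of its orthogonal complement. The modes in \<open>B1\<close> are not
  excited by \<open>M - P Mh\<close>, and those in \<open>B2\<close> are excited exactly as by \<open>M\<close>. The eigenvalues of \<open>B1\<close> are
  those of the reduced Laplacian with multiplicities, so those of \<open>B2\<close> form the multiset difference
  of the spectra (\<open>spectrum_orthonormal_eigenbasis\<close>, \<open>spectrum_red_laplacian\<close>).

  The weights over \<open>B2\<close> add up to the squared distances of the leaders' unit vectors from the
  invariant space, that is, to the sum of \<open>1 - 1 / card (C (c i))\<close> (\<open>sum_projection_unit_vector\<close>); bounding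
  each mode by the maximal one gives the first inequality. For the second, the weights over all modes
  with nonzero eigenvalue add up to \<open>m (1 - 1 / N)\<close> at least, since the kernel of \<open>L\<close> consists of the
  constant vectors (\<open>sum_kernel_unit_vector\<close>), and each such mode is bounded below by the minimal one.
\<close>

section \<open>Kronecker products and complexification\<close>

lemma kron_mult:
  fixes X :: "'a::comm_semiring_1 ^ 'q ^ 'p" and Y :: "'a ^ 's ^ 't"
  shows "kron X Y ** kron Z W = kron (X ** Z) (Y ** W)"
  by (simp add: vec_eq_iff kron_def matrix_matrix_mult_def sum_product sum.cartesian_product
      mult_ac UNIV_Times_UNIV[symmetric] case_prod_beta del: UNIV_Times_UNIV)

lemma transpose_kron: "transpose (kron X Y) = kron (transpose X) (transpose Y)"
  by (simp add: vec_eq_iff kron_def transpose_def)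

lemma trace_kron:
  fixes X :: "'a::comm_semiring_1 ^ 'p ^ 'p" and Y :: "'a ^ 't ^ 't"
  shows "trace (kron X Y) = trace X * trace Y"
  by (simp add: kron_def trace_def sum_product sum.cartesian_product
       UNIV_Times_UNIV[symmetric] case_prod_beta del: UNIV_Times_UNIV)

lemma kron_mat_mat: "kron (mat a) (mat b) = (mat (a * b) :: 'a::semiring_1 ^ _ ^ _)"
  by (auto simp: vec_eq_iff kron_def mat_def prod_eq_iff)

lemma kron_diff_left: "kron (X - X') (Y :: 'a::ring ^ _ ^ _) = kron X Y - kron X' Y"
  by (simp add: vec_eq_iff kron_def algebra_simps)

lemma kron_diff_right: "kron (X :: 'a::ring ^ _ ^ _) (Y - Y') = kron X Y - kron X Y'"
  by (simp add: vec_eq_iff kron_def algebra_simps)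

lemma kron_sum_left:
  "kron (\<Sum>u\<in>U. X u) (Y :: 'a::comm_ring_1 ^ _ ^ _) = (\<Sum>u\<in>U. kron (X u) Y)"
  by (simp add: vec_eq_iff kron_def sum_distrib_right)

lemma kron_scaleR_swap:
  "kron (c *\<^sub>R X) Y = kron X (c *\<^sub>R (Y :: complex ^ _ ^ _))"
  by (simp add: vec_eq_iff kron_def)

lemma cmat_mult: "cmat (X ** Y) = cmat X ** cmat Y"
  by (simp add: vec_eq_iff cmat_def matrix_matrix_mult_def)

lemma cmat_kron: "cmat (kron X Y) = kron (cmat X) (cmat Y)"
  by (simp add: vec_eq_iff cmat_def kron_def)

lemma cmat_mat: "cmat (mat c) = mat (of_real c)"
  by (simp add: vec_eq_iff cmat_def mat_def)

lemma cmat_diff: "cmat (X - Y) = cmat X - cmat Y"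
  by (simp add: vec_eq_iff cmat_def)

lemma cmat_scaleR: "cmat (c *\<^sub>R X) = c *\<^sub>R cmat X"
  by (simp add: vec_eq_iff cmat_def) (simp add: scaleR_conv_of_real)

lemma cmat_transpose: "cmat (transpose X) = transpose (cmat X)"
  by (simp add: vec_eq_iff cmat_def transpose_def)

lemma cmat_sum: "cmat (\<Sum>u\<in>U. X u) = (\<Sum>u\<in>U. cmat (X u))"
  by (simp add: vec_eq_iff cmat_def)

lemma matrix_mul_scaleR_left: "(c *\<^sub>R X) ** Y = c *\<^sub>R (X ** (Y :: 'a::real_algebra_1 ^ _ ^ _))"
  by (simp add: vec_eq_iff matrix_matrix_mult_def scaleR_sum_right)

lemma matrix_mul_scaleR_right: "X ** (c *\<^sub>R Y) = c *\<^sub>R (X ** (Y :: 'a::real_algebra_1 ^ _ ^ _))"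
  by (simp add: vec_eq_iff matrix_matrix_mult_def scaleR_sum_right)

lemma matrix_mul_diff_left: "(X - X') ** Y = X ** Y - X' ** (Y :: 'a::ring_1 ^ _ ^ _)"
  by (simp add: vec_eq_iff matrix_matrix_mult_def left_diff_distrib sum_subtractf)

lemma matrix_mul_diff_right: "X ** (Y - Y') = X ** Y - X ** (Y' :: 'a::ring_1 ^ _ ^ _)"
  by (simp add: vec_eq_iff matrix_matrix_mult_def right_diff_distrib sum_subtractf)

lemma matrix_mul_sum_left: "(\<Sum>u\<in>U. X u) ** Y = (\<Sum>u\<in>U. X u ** (Y :: 'a::comm_ring_1 ^ _ ^ _))"
  unfolding vec_eq_iff matrix_matrix_mult_def
  by (auto simp: sum_distrib_right intro: sum.swap)

lemma matrix_mul_sum_right: "X ** (\<Sum>u\<in>U. Y u) = (\<Sum>u\<in>U. X ** (Y u :: 'a::comm_ring_1 ^ _ ^ _))"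
  unfolding vec_eq_iff matrix_matrix_mult_def
  by (auto simp: sum_distrib_left intro: sum.swap)

lemma trace_sum: "trace (\<Sum>u\<in>U. X u) = (\<Sum>u\<in>U. trace (X u :: 'a::comm_ring_1 ^ _ ^ _))"
  unfolding trace_def sum_component by (rule sum.swap)

lemma transpose_sum: "transpose (\<Sum>u\<in>U. X u) = (\<Sum>u\<in>U. transpose (X u :: 'a::comm_ring_1 ^ _ ^ _))"
  by (simp add: vec_eq_iff transpose_def)

lemma matrix_inv_mult:
  fixes X :: "'a::field ^ 'n ^ 'n"
  assumes "invertible X"
  shows "X ** matrix_inv X = mat 1" "matrix_inv X ** X = mat 1"
proof -
  have "\<exists>Y. X ** Y = mat 1 \<and> Y ** X = mat 1"
    using assms unfolding invertible_def .
  from someI_ex[OF this] show "X ** matrix_inv X = mat 1" "matrix_inv X ** X = mat 1"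
    unfolding matrix_inv_def by auto
qed

lemma invertibleI:
  fixes X Y :: "'a::field ^ 'n ^ 'n"
  assumes "X ** Y = mat 1"
  shows "invertible X"
  using assms invertible_right_inverse by blast

lemma matrix_inv_eqI:
  fixes X Y :: "'a::field ^ 'n ^ 'n"
  assumes "X ** Y = mat 1"
  shows "matrix_inv X = Y"
  by (metis assms invertibleI matrix_inv_mult(2) matrix_mul_assoc matrix_mul_lid matrix_mul_rid)

section \<open>The resolvent of a complex matrix\<close>

lemma poly_det: "poly (det M) s = det (\<chi> i j. poly (M $ i $ j) s)"
  by (simp add: det_def poly_sum poly_prod)

lemma norm_mat_mult:
  fixes X :: "complex ^ 'm ^ 'n"
  shows "norm (mat s ** X) = norm s * norm X"
proof -
  have "mat s ** X = (\<chi> i j. s * X $ i $ j)"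
    by (simp add: vec_eq_iff matrix_matrix_mult_def mat_def if_distrib if_distribR cong: if_cong)
  then show ?thesis
    by (simp add: norm_vec_def norm_mult L2_set_right_distrib)
qed

lemma matrix_mult_bound:
  fixes F :: "complex ^ 'n ^ 'p"
  obtains K where "K > 0" "\<And>X :: complex ^ 'm ^ 'n. norm (F ** X) \<le> K * norm X"
proof -
  have "linear (\<lambda>X :: complex ^ 'm ^ 'n. F ** X)"
    by (intro linearI) (auto simp: matrix_add_ldistrib matrix_mul_scaleR_right)
  from linear_bounded_pos[OF this] show ?thesis
    using that by (metis mult.commute)
qed

lemma matrix_mult_bound_left:
  fixes F :: "complex ^ 'm ^ 'n"
  obtains K where "K > 0" "\<And>X :: complex ^ 'n ^ 'p. norm (X ** F) \<le> K * norm X"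
proof -
  have "linear (\<lambda>X :: complex ^ 'n ^ 'p. X ** F)"
    by (intro linearI) (auto simp: vec_eq_iff matrix_matrix_mult_def distrib_right sum.distrib matrix_mul_scaleR_left scaleR_sum_right)
  from linear_bounded_pos[OF this] show ?thesis
    using that by (metis mult.commute)
qed

lemma not_invertible_eigenvector:
  fixes F :: "'a::field ^ 'n ^ 'n"
  assumes "\<not> invertible (mat s - F)"
  obtains z where "z \<noteq> 0" "F *v z = s *s z"
proof -
  from assms have "\<not> (\<exists>Y. Y ** (mat s - F) = mat 1)"
    using invertible_left_inverse by blast
  then obtain z where z: "(mat s - F) *v z = 0" "z \<noteq> 0"
    unfolding matrix_left_invertible_ker by blast
  have "mat s *v z = s *s z"
    by (simp add: vec_eq_iff matrix_vector_mult_def mat_def if_distrib if_distribR cong: if_cong)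
  with z have "F *v z = s *s z"
    by (simp add: matrix_vector_mult_diff_rdistrib)
  with z(2) show ?thesis by (rule that)
qed

text \<open>The identity \<open>s R(s) = I + F R(s)\<close> for the resolvent \<open>R(s)\<close> shows that \<open>R(s)\<close> is of order
  \<open>1 / |s|\<close> as soon as \<open>|s|\<close> dominates the operator norm of \<open>F\<close>. This decay is what makes
  strictly proper stable systems square integrable on the imaginary axis.\<close>

lemma resolvent_large:
  fixes F :: "complex ^ 'n ^ 'n"
  obtains K c where "K > 0" "c > 0" "\<And>s. norm s \<ge> K \<Longrightarrow> invertible (mat s - F)"
    "\<And>s. norm s \<ge> K \<Longrightarrow> norm (matrix_inv (mat s - F)) \<le> c / norm s"
proof -
  obtain K where K: "K > 0" "\<And>X :: complex ^ 'n ^ 'n. norm (F ** X) \<le> K * norm X"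
    using matrix_mult_bound[of F, where 'm = 'n] by blast
  obtain K1 where K1: "K1 > 0" "\<And>X :: complex ^ 1 ^ 'n. norm (F ** X) \<le> K1 * norm X"
    using matrix_mult_bound[of F, where 'm = 1] by blast
  \<comment> \<open>Twice the bounds: then \<open>F\<close> absorbs at most half of \<open>|s|\<close> in the estimate of the resolvent.\<close>
  define R where "R = 2 * K + 2 * K1"
  define c where "c = 2 * norm (mat 1 :: complex ^ 'n ^ 'n) + 1"
  have inv: "invertible (mat s - F)" if s: "norm s \<ge> R" for s
  proof (rule ccontr)
    assume "\<not> invertible (mat s - F)"
    then obtain z where z: "z \<noteq> 0" "F *v z = s *s z" using not_invertible_eigenvector by blast
    define X :: "complex ^ 1 ^ 'n" where "X = (\<chi> i j. z $ i)"
    have "F ** X = mat s ** X"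
      using z(2) by (simp add: vec_eq_iff X_def matrix_matrix_mult_def matrix_vector_mult_def mat_def 
        if_distrib if_distribR cong: if_cong)
    then have "norm s * norm X \<le> K1 * norm X"
      using K1(2)[of X] by (simp add: norm_mat_mult)
    moreover have "norm X > 0"
      using z(1) by (auto simp: X_def vec_eq_iff)
    ultimately have "norm s \<le> K1" by simp
    with s K K1 show False by (simp add: R_def)
  qed
  have bd: "norm (matrix_inv (mat s - F)) \<le> c / norm s" if s: "norm s \<ge> R" for s
  proof -
    let ?X = "matrix_inv (mat s - F)"
    have "(mat s - F) ** ?X = mat 1" using matrix_inv_mult inv[OF s] by blast
    then have "mat s ** ?X = mat 1 + F ** ?X"
      by (simp add: matrix_mul_diff_left algebra_simps)
    then have "norm s * norm ?X \<le> norm (mat 1 :: complex ^ 'n ^ 'n) + K * norm ?X"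
      using norm_triangle_ineq[of "mat 1" "F ** ?X"] K(2)[of ?X] norm_mat_mult[of s ?X] by simp
    moreover have "2 * K * norm ?X \<le> norm s * norm ?X"
      using s K1(1) by (intro mult_right_mono) (auto simp: R_def)
    ultimately have "norm s * norm ?X \<le> c" by (simp add: c_def)
    moreover have "norm s > 0" using s K(1) K1(1) unfolding R_def by linarith
    ultimately show ?thesis by (simp add: field_simps)
  qed
  show ?thesis
    by (rule that[of R c]) (use K K1 inv bd in \<open>auto simp: R_def c_def add_nonneg_pos\<close>)
qed

text \<open>The exceptional points are the roots of the characteristic polynomial, which is nonzero
  because it does not vanish for large arguments.\<close>

lemma finite_not_invertible_resolvent:
  fixes F :: "complex ^ 'n ^ 'n"
  shows "finite {s. \<not> invertible (mat s - F)}"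
proof -
  define p where "p = det (\<chi> i j. (if i = j then [:0, 1:] else 0) - [:F $ i $ j:])"
  have p: "poly p s = det (mat s - F)" for s
    unfolding p_def poly_det
    by (rule arg_cong[where f = det]) (simp add: vec_eq_iff mat_def)
  obtain K where "K > 0" "\<And>s. norm s \<ge> K \<Longrightarrow> invertible (mat s - F)"
    using resolvent_large[of F] by metis
  then have "invertible (mat (of_real K) - F)" by simp
  then have "p \<noteq> 0" using p[of "of_real K"] by (auto simp: invertible_det_nz)
  then have "finite {s. poly p s = 0}" by (rule poly_roots_finite)
  then show ?thesis by (simp add: p invertible_det_nz)
qed

lemma isCont_det:
  fixes f :: "'t::t2_space \<Rightarrow> 'a::{real_normed_field} ^ 'n ^ 'n"
  assumes "\<And>i j. isCont (\<lambda>s. f s $ i $ j) x"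
  shows "isCont (\<lambda>s. det (f s)) x"
  unfolding det_def by (intro continuous_intros assms)

lemma matrix_inv_cramer:
  fixes X :: "'a::field ^ 'n ^ 'n"
  assumes "invertible X"
  shows "matrix_inv X $ i $ j =
     det (\<chi> k l. if l = i then (if k = j then 1 else 0) else X $ k $ l) / det X"
proof -
  let ?b = "(\<chi> k. if k = j then 1 else 0) :: 'a ^ 'n"
  have "X *v (\<chi> k. matrix_inv X $ k $ j) = ?b"
    using matrix_inv_mult(1)[OF assms]
    by (simp add: vec_eq_iff matrix_matrix_mult_def matrix_vector_mult_def mat_def)
  then have "(\<chi> k. matrix_inv X $ k $ j) =
      (\<chi> k. det (\<chi> i l. if l = k then ?b $ i else X $ i $ l) / det X)"
    using assms by (subst cramer[symmetric]) (simp_all add: invertible_det_nz)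
  from arg_cong[OF this, of "\<lambda>x. x $ i"] show ?thesis
    by (simp cong: if_cong)
qed

text \<open>By Cramer's rule the entries are quotients of determinants, hence continuous wherever the
  denominator does not vanish.\<close>

lemma isCont_resolvent:
  fixes F :: "complex ^ 'n ^ 'n"
  assumes "invertible (mat s - F)"
  shows "isCont (\<lambda>s. matrix_inv (mat s - F) $ i $ j) s"
proof -
  have c: "isCont (\<lambda>s. (mat s - F) $ i $ j) t" for i j t
    by (cases "i = j") (simp_all add: mat_def)
  have d: "isCont (\<lambda>s. det (mat s - F)) t" for t
    by (rule isCont_det) (rule c)
  have "isCont (\<lambda>s. det (\<chi> k l. if l = i then (if k = j then 1 else 0) else (mat s - F) $ k $ l)) s"
  proof (rule isCont_det)
    fix k l
    show "isCont (\<lambda>s. (\<chi> k l. if l = i then (if k = j then 1 else 0) else (mat s - F) $ k $ l) $ k $ l) s"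
      using c[where t = s and i = k and j = l] by (cases "l = i") auto
  qed
  then have "isCont (\<lambda>s. det (\<chi> k l. if l = i then (if k = j then 1 else 0) else (mat s - F) $ k $ l) / det (mat s - F)) s"
    using d by (rule isCont_divide) (use assms in \<open>simp add: invertible_det_nz\<close>)
  moreover have "eventually (\<lambda>s. det (mat s - F) \<noteq> 0) (nhds s)"
    using d[of s] assms unfolding invertible_det_nz continuous_at
    by (intro tendsto_imp_eventually_ne) (auto simp: tendsto_nhds_iff isCont_def)
  then have "eventually (\<lambda>s. matrix_inv (mat s - F) $ i $ j =
     det (\<chi> k l. if l = i then (if k = j then 1 else 0) else (mat s - F) $ k $ l) / det (mat s - F)) (nhds s)"
    by eventually_elim (simp add: matrix_inv_cramer invertible_det_nz)
  ultimately show ?thesis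
    by (subst isCont_cong) 
qed

section \<open>Stable transfer functions and the H2 norm\<close>

text \<open>All eigenvalues lie in the open left half plane, phrased as invertibility on the closed
  right half plane, which is the form in which the resolvent uses it.\<close>

definition hurwitz :: "real ^ 'n ^ 'n \<Rightarrow> bool"
  where "hurwitz F \<longleftrightarrow> (\<forall>s. 0 \<le> Re s \<longrightarrow> invertible (mat s - cmat F))"

text \<open>The integrand of \<^const>\<open>h2_norm\<close>.\<close>

definition energy :: "(complex \<Rightarrow> complex ^ 'u::finite ^ 'y::finite) \<Rightarrow> real \<Rightarrow> complex"
  where "energy G \<omega> =
    trace (transpose (G (- (\<i> * complex_of_real \<omega>))) ** G (\<i> * complex_of_real \<omega>))"

lemma eventually_notin_finite:
  fixes s :: "'a::t1_space"
  assumes "finite Z"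
  shows "eventually (\<lambda>z. z \<notin> Z) (at s)"
proof -
  have "open (- (Z - {s}))" using assms by (intro open_Compl finite_imp_closed) auto
  then have "eventually (\<lambda>z. z \<in> - (Z - {s})) (nhds s)"
    by (rule eventually_nhds_in_open) auto
  then show ?thesis
    by (auto simp: eventually_at_filter elim: eventually_mono)
qed

lemma isCont_transfer_function:
  assumes "hurwitz F" "0 \<le> Re s"
  shows "isCont (\<lambda>z. transfer_function F G H z $ i $ j) s"
proof -
  have "isCont (\<lambda>z. matrix_inv (mat z - cmat F) $ k $ l) s" for k l
    using assms by (intro isCont_resolvent) (auto simp: hurwitz_def)
  then show ?thesis
    unfolding transfer_function_def matrix_matrix_mult_def by (simp add: continuous_intros)
qed

text \<open>A pole is a limit over punctured neighbourhoods, so the values of \<open>G\<close> on a finite set are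
  irrelevant. Hence a possible cancellation of unstable modes of \<open>A\<close> itself in the network is
  handled by exhibiting a representative that is continuous on the closed right half plane.\<close>

lemma stable_poles_if_eq_isCont:
  fixes G H :: "complex \<Rightarrow> complex ^ 'u ^ 'y"
  assumes "finite Z" "\<And>z. z \<notin> Z \<Longrightarrow> G z = H z"
    and "\<And>i j s. 0 \<le> Re s \<Longrightarrow> isCont (\<lambda>z. H z $ i $ j) s"
  shows "stable_poles G"
  unfolding stable_poles_def
proof (intro allI impI)
  fix i j s
  assume p: "is_pole (\<lambda>z. G z $ i $ j) s"
  show "Re s < 0"
  proof (rule ccontr)
    assume "\<not> Re s < 0"
    then have "((\<lambda>z. H z $ i $ j) \<longlongrightarrow> H s $ i $ j) (at s)"
      using assms(3)[of s i j] by (simp add: isCont_def)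
    moreover have "eventually (\<lambda>z. H z $ i $ j = G z $ i $ j) (at s)"
      using eventually_notin_finite[OF assms(1)] by eventually_elim (simp add: assms(2))
    ultimately have "((\<lambda>z. G z $ i $ j) \<longlongrightarrow> H s $ i $ j) (at s)"
      by (rule Lim_transform_eventually)
    with p show False
      unfolding is_pole_def using not_tendsto_and_filterlim_at_infinity[OF at_neq_bot] by blast
  qed
qed

lemma cmat_cnj: "map_matrix cnj (cmat X) = cmat X"
  by (simp add: vec_eq_iff cmat_def)

lemma map_matrix_cnj_mult: "map_matrix cnj (X ** Y) = map_matrix cnj X ** map_matrix cnj Y"
  by (simp add: vec_eq_iff matrix_matrix_mult_def)

text \<open>The system matrices are real.\<close>

lemma transfer_function_cnj:
  assumes "invertible (mat s - cmat F)"
  shows "transfer_function F G H (cnj s) = map_matrix cnj (transfer_function F G H s)"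
proof -
  have "(mat (cnj s) - cmat F) = map_matrix cnj (mat s - cmat F)"
    by (simp add: vec_eq_iff mat_def cmat_def)
  moreover have "map_matrix cnj (mat s - cmat F) ** map_matrix cnj (matrix_inv (mat s - cmat F)) = mat 1"
    unfolding map_matrix_cnj_mult[symmetric] matrix_inv_mult(1)[OF assms]
    by (simp add: vec_eq_iff mat_def)
  ultimately have "matrix_inv (mat (cnj s) - cmat F) = map_matrix cnj (matrix_inv (mat s - cmat F))"
    using matrix_inv_eqI by metis
  then show ?thesis
    unfolding transfer_function_def map_matrix_cnj_mult cmat_cnj by simp
qed

text \<open>By conjugation symmetry the integrand is a sum of squared moduli; this gives the
  nonnegativity that makes \<^const>\<open>h2_norm\<close> a genuine square root.\<close>

lemma energy_transfer_function:
  assumes "hurwitz F"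
  shows "energy (transfer_function F G H) \<omega> =
    of_real (\<Sum>j\<in>UNIV. \<Sum>i\<in>UNIV. (norm (transfer_function F G H (\<i> * of_real \<omega>) $ i $ j))\<^sup>2)"
proof -
  have "invertible (mat (\<i> * of_real \<omega>) - cmat F)"
    using assms by (simp add: hurwitz_def)
  from transfer_function_cnj[OF this, of G H]
  have "transfer_function F G H (- (\<i> * of_real \<omega>)) =
    map_matrix cnj (transfer_function F G H (\<i> * of_real \<omega>))" by simp
  then show ?thesis
    unfolding energy_def trace_def
    by (simp add: matrix_matrix_mult_def transpose_def complex_norm_square mult.commute
        del: of_real_power)
qed

text \<open>On a compact interval \<open>f\<close> is bounded by continuity; together with the decay outside of it,
  a multiple of \<open>1 / (1 + x\<^sup>2)\<close> dominates \<open>f\<close> everywhere.\<close>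

lemma integrable_quadratic_decay:
  fixes f :: "real \<Rightarrow> complex"
  assumes cont: "continuous_on UNIV f"
    and decay: "\<And>x. \<bar>x\<bar> \<ge> R \<Longrightarrow> norm (f x) \<le> D / x\<^sup>2"
  shows "integrable lborel f"
proof -
  define R' where "R' = max R 1"
  have "compact (f ` {-R'..R'})"
    by (intro compact_continuous_image continuous_on_subset[OF cont]) auto
  then obtain b where b: "b > 0" "\<And>x. x \<in> {-R'..R'} \<Longrightarrow> norm (f x) \<le> b"
    using compact_imp_bounded bounded_pos by (metis imageI)
  define c where "c = b * (1 + R'\<^sup>2) + 2 * \<bar>D\<bar>"
  have bd: "norm (f x) \<le> norm (c * inverse (1 + x\<^sup>2))" for x
  proof -
    have pos: "1 + x\<^sup>2 > 0" by (simp add: add_pos_nonneg)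
    have c0: "c \<ge> 0" using b by (simp add: c_def)
    have "norm (f x) * (1 + x\<^sup>2) \<le> c"
    proof (cases "\<bar>x\<bar> \<le> R'")
      case True
      then have "x\<^sup>2 \<le> R'\<^sup>2" by (metis abs_ge_zero power2_abs power_mono)
      moreover have "norm (f x) \<le> b" using True by (intro b(2)) auto
      ultimately have "norm (f x) * (1 + x\<^sup>2) \<le> b * (1 + R'\<^sup>2)"
        using b(1) by (intro mult_mono) auto
      then show ?thesis by (simp add: c_def)
    next
      case False
      then have x: "\<bar>x\<bar> \<ge> 1" "\<bar>x\<bar> \<ge> R" by (auto simp: R'_def)
      have x2: "x\<^sup>2 \<ge> 1" using one_le_power[OF x(1), of 2] by simp
      have "norm (f x) * (1 + x\<^sup>2) \<le> (\<bar>D\<bar> / x\<^sup>2) * (2 * x\<^sup>2)"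
      proof (intro mult_mono)
        show "norm (f x) \<le> \<bar>D\<bar> / x\<^sup>2"
          using decay[OF x(2)] by (rule order_trans) (simp add: divide_right_mono)
      qed (use x2 in auto)
      also have "\<dots> = 2 * \<bar>D\<bar>" using x2 by auto
      finally show ?thesis using b by (simp add: c_def add_increasing)
    qed
    with pos c0 show ?thesis by (simp add: field_simps abs_mult)
  qed
  have int: "integrable lborel (\<lambda>x::real. c * inverse (1 + x\<^sup>2))"
    using integrable_inverse_1_plus_square
    by (simp add: set_integrable_def einterval_def)
  have meas: "f \<in> borel_measurable lborel"
    using borel_measurable_continuous_onI[OF cont] by simp
  show ?thesis
    by (rule Bochner_Integration.integrable_bound[OF int meas]) (rule AE_I2, rule bd)
qed

lemma transfer_function_decay:
  fixes F :: "real ^ 'n ^ 'n" and G :: "real ^ 'u ^ 'n" and H :: "real ^ 'n ^ 'y"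
  obtains R c where "\<And>s i j. norm s \<ge> R \<Longrightarrow> norm (transfer_function F G H s $ i $ j) \<le> c / norm s"
proof -
  obtain K c where K: "K > 0" "c > 0" 
    "\<And>s. norm s \<ge> K \<Longrightarrow> norm (matrix_inv (mat s - cmat F)) \<le> c / norm s"
    using resolvent_large[of "cmat F"] by metis
  obtain K1 where K1: "K1 > 0" "\<And>X :: complex ^ 'n ^ 'n. norm (cmat H ** X) \<le> K1 * norm X"
    by (rule matrix_mult_bound[of "cmat H", where 'm = 'n]) blast
  obtain K2 where K2: "K2 > 0" "\<And>X :: complex ^ 'n ^ 'y. norm (X ** cmat G) \<le> K2 * norm X"
    by (rule matrix_mult_bound_left[of "cmat G", where 'p = 'y]) blast
  show ?thesis
  proof (rule that[of K "K2 * (K1 * c)"])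
    fix s :: complex and i j assume s: "norm s \<ge> K"
    have "norm (transfer_function F G H s $ i $ j) \<le> norm (transfer_function F G H s)"
      by (rule order_trans[OF Finite_Cartesian_Product.norm_nth_le Finite_Cartesian_Product.norm_nth_le])
    also have "\<dots> \<le> K2 * norm (cmat H ** matrix_inv (mat s - cmat F))"
      unfolding transfer_function_def by (rule K2)
    also have "\<dots> \<le> K2 * (K1 * norm (matrix_inv (mat s - cmat F)))"
      using K1 K2 by (intro mult_left_mono) auto
    also have "\<dots> \<le> K2 * (K1 * (c / norm s))"
      using K1 K2 K(3)[OF s] by (intro mult_left_mono) auto
    finally show "norm (transfer_function F G H s $ i $ j) \<le> K2 * (K1 * c) / norm s" by simp
  qed
qed

lemma integrable_energy:
  fixes G :: "real ^ 'u ^ 'n" and H :: "real ^ 'n ^ 'y"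
  assumes "hurwitz F"
  shows "integrable lborel (energy (transfer_function F G H))"
proof -
  obtain R c where d: "\<And>s i j. norm s \<ge> R \<Longrightarrow> norm (transfer_function F G H s $ i $ j) \<le> c / norm s"
    using transfer_function_decay[of F G H] by metis
  show ?thesis
  proof (rule integrable_quadratic_decay)
    have "isCont (\<lambda>\<omega>. transfer_function F G H (\<i> * of_real \<omega>) $ i $ j) x" for x :: real and i j
    proof (rule isCont_o2[where f = "\<lambda>\<omega>. \<i> * of_real \<omega>" and
              g = "\<lambda>z. transfer_function F G H z $ i $ j"])
      show "isCont (\<lambda>\<omega>. \<i> * of_real \<omega>) x" by (intro continuous_intros)
      show "isCont (\<lambda>z. transfer_function F G H z $ i $ j) (\<i> * of_real x)"
        using assms by (rule isCont_transfer_function) simp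
    qed
    then show "continuous_on UNIV (energy (transfer_function F G H))"
      unfolding energy_transfer_function[OF assms] continuous_on_eq_continuous_at[OF open_UNIV]
      by (intro ballI continuous_of_real continuous_sum continuous_power continuous_norm)
  next
    fix x :: real assume x: "\<bar>x\<bar> \<ge> R"
    have "(norm (transfer_function F G H (\<i> * of_real x) $ i $ j))\<^sup>2 \<le> (c / \<bar>x\<bar>)\<^sup>2" for i j
      using d[of "\<i> * of_real x" i j] x by (intro power_mono) (auto simp: norm_mult)
    then have "(\<Sum>j\<in>UNIV. \<Sum>i\<in>UNIV. (norm (transfer_function F G H (\<i> * of_real x) $ i $ j))\<^sup>2)
      \<le> (\<Sum>j\<in>(UNIV :: 'u set). \<Sum>i\<in>(UNIV :: 'y set). (c / \<bar>x\<bar>)\<^sup>2)"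
      by (intro sum_mono)
    then show "norm (energy (transfer_function F G H) x) \<le> (real CARD('u) * (real CARD('y) * c\<^sup>2)) / x\<^sup>2"
      unfolding energy_transfer_function[OF assms] norm_of_real
      by (subst abs_of_nonneg) (simp_all add: power_divide sum_nonneg)
  qed
qed

lemma h2_norm_sq_transfer_function:
  assumes "hurwitz F"
  shows "of_real ((h2_norm (transfer_function F G H))\<^sup>2) = 1 / (2 * pi) * (LINT \<omega>|lborel. energy (transfer_function F G H) \<omega>)"
    and "h2_norm (transfer_function F G H) \<ge> 0"
proof -
  have st: "stable_poles (transfer_function F G H)"
    by (rule stable_poles_if_eq_isCont[of "{}"]) (auto intro: isCont_transfer_function[OF assms])
  define f where "f \<omega> = (\<Sum>j\<in>UNIV. \<Sum>i\<in>UNIV. (norm (transfer_function F G H (\<i> * of_real \<omega>) $ i $ j))\<^sup>2)"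
    for \<omega>
  have e: "energy (transfer_function F G H) = (\<lambda>\<omega>. of_real (f \<omega>))"
    by (rule ext) (simp only: energy_transfer_function[OF assms] f_def)
  have "(LINT \<omega>|lborel. energy (transfer_function F G H) \<omega>) = of_real (LINT \<omega>|lborel. f \<omega>)"
    unfolding e by simp
  moreover have "(LINT \<omega>|lborel. f \<omega>) \<ge> 0"
    by (intro integral_nonneg_AE) (auto simp: f_def intro!: sum_nonneg)
  moreover have "h2_norm (transfer_function F G H) = sqrt (1 / (2 * pi) * Re (LINT \<omega>|lborel. energy (transfer_function F G H) \<omega>))"
    using st by (simp add: h2_norm_def energy_def)
  ultimately show "of_real ((h2_norm (transfer_function F G H))\<^sup>2) = 1 / (2 * pi) * (LINT \<omega>|lborel. energy (transfer_function F G H) \<omega>)"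
    "h2_norm (transfer_function F G H) \<ge> 0" by simp_all
qed

text \<open>The trace of a Kronecker product factors, so trace orthogonality of the left factors removes
  all cross terms between different modes.\<close>

lemma energy_orthogonal_sum:
  fixes X :: "'i \<Rightarrow> complex ^ 'm ^ 'v" and S :: "'i \<Rightarrow> complex \<Rightarrow> complex ^ 'r ^ 'n"
  assumes "finite U"
    and orth: "\<And>u u'. u \<in> U \<Longrightarrow> u' \<in> U \<Longrightarrow>
      trace (transpose (X u) ** X u') = (if u = u' then of_real (w u) else 0)"
    and "G (\<i> * of_real \<omega>) = (\<Sum>u\<in>U. kron (X u) (S u (\<i> * of_real \<omega>)))"
    and "G (- (\<i> * of_real \<omega>)) = (\<Sum>u\<in>U. kron (X u) (S u (- (\<i> * of_real \<omega>))))"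
  shows "energy G \<omega> = (\<Sum>u\<in>U. of_real (w u) * energy (S u) \<omega>)"
proof -
  have "energy G \<omega> = (\<Sum>u\<in>U. \<Sum>u'\<in>U. trace (transpose (X u) ** X u') *
      trace (transpose (S u (- (\<i> * of_real \<omega>))) ** S u' (\<i> * of_real \<omega>)))"
    unfolding energy_def assms(3,4)
    unfolding transpose_sum matrix_mul_sum_left trace_sum
    unfolding matrix_mul_sum_right trace_sum transpose_kron kron_mult trace_kron ..
  also have "\<dots> = (\<Sum>u\<in>U. \<Sum>u'\<in>U. if u = u' then of_real (w u) * energy (S u) \<omega> else 0)"
    by (intro sum.cong refl) (auto simp: orth energy_def)
  finally show ?thesis using assms(1) by simp
qed

text \<open>Pythagoras for the H2 norm. The representation of \<open>G\<close> is only required off a finite set, which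
  affects neither the poles nor the integral over the imaginary axis.\<close>

lemma h2_norm_orthogonal_sum:
  fixes X :: "'i \<Rightarrow> complex ^ 'm::finite ^ 'v::finite"
    and G :: "complex \<Rightarrow> complex ^ ('m::finite \<times> 'r::finite) ^ ('v::finite \<times> 'n::finite)"
  assumes "finite U" "finite Z"
    and orth: "\<And>u u'. u \<in> U \<Longrightarrow> u' \<in> U \<Longrightarrow>
      trace (transpose (X u) ** X u') = (if u = u' then of_real (w u) else 0)"
    and w: "\<And>u. u \<in> U \<Longrightarrow> w u \<ge> 0"
    and F: "\<And>u. u \<in> U \<Longrightarrow> hurwitz (F u)"
    and G: "\<And>s. s \<notin> Z \<Longrightarrow> G s = (\<Sum>u\<in>U. kron (X u) (transfer_function (F u) (E u) (H u) s))"
  shows "(h2_norm G)\<^sup>2 = (\<Sum>u\<in>U. w u * (h2_norm (transfer_function (F u) (E u) (H u)))\<^sup>2)"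
proof -
  let ?S = "\<lambda>u. transfer_function (F u) (E u) (H u)"
  have st: "stable_poles G"
    by (rule stable_poles_if_eq_isCont[OF assms(2) G])
      (auto simp: kron_def intro!: continuous_sum continuous_mult continuous_const
        isCont_transfer_function F)
  \<comment> \<open>Both points at which the integrand evaluates \<open>G\<close> have to avoid the exceptional set.\<close>
  define N where "N = {\<omega>::real. \<i> * of_real \<omega> \<in> Z \<or> - (\<i> * of_real \<omega>) \<in> Z}"
  have "finite ((\<lambda>z. Im z) ` Z \<union> (\<lambda>z. - Im z) ` Z)" using assms(2) by simp
  moreover have "N \<subseteq> (\<lambda>z. Im z) ` Z \<union> (\<lambda>z. - Im z) ` Z"
  proof
    fix \<omega> assume "\<omega> \<in> N"
    then show "\<omega> \<in> (\<lambda>z. Im z) ` Z \<union> (\<lambda>z. - Im z) ` Z"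
      unfolding N_def by (force simp: image_iff)
  qed
  ultimately have fin: "finite N" by (rule finite_subset[rotated])
  have int: "integrable lborel (energy (?S u))" if "u \<in> U" for u
    using F[OF that] by (rule integrable_energy)
  have sq: "(LINT \<omega>|lborel. energy (?S u) \<omega>) = of_real (2 * pi * (h2_norm (?S u))\<^sup>2)" if "u \<in> U" for u
    using h2_norm_sq_transfer_function(1)[OF F[OF that], of "E u" "H u"] by (simp add: field_simps)
  have "(LINT \<omega>|lborel. energy G \<omega>) = (LINT \<omega>|lborel. (\<Sum>u\<in>U. of_real (w u) * energy (?S u) \<omega>))"
  proof (rule integral_discrete_difference[where X = N])
    show "countable N" using fin by (rule countable_finite)
    show "energy G \<omega> = (\<Sum>u\<in>U. of_real (w u) * energy (?S u) \<omega>)" if "\<omega> \<notin> N" for \<omega>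
      using that by (intro energy_orthogonal_sum[where X = X] assms(1) orth G) (auto simp: N_def)
  qed auto
  also have "\<dots> = (\<Sum>u\<in>U. of_real (w u) * (LINT \<omega>|lborel. energy (?S u) \<omega>))"
    using int by (subst Bochner_Integration.integral_sum) auto
  also have "\<dots> = of_real (2 * pi * (\<Sum>u\<in>U. w u * (h2_norm (?S u))\<^sup>2))"
    by (simp add: sq sum_distrib_left mult_ac)
  finally have "h2_norm G = sqrt (\<Sum>u\<in>U. w u * (h2_norm (?S u))\<^sup>2)"
    using st by (simp add: h2_norm_def energy_def)
  moreover have "(\<Sum>u\<in>U. w u * (h2_norm (?S u))\<^sup>2) \<ge> 0"
    by (intro sum_nonneg mult_nonneg_nonneg w) auto
  ultimately show ?thesis by simp
qed

section \<open>Orthonormal eigenbases and the spectrum\<close>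

text \<open>A maximizer of the Rayleigh quotient on the unit sphere of \<open>S\<close> is an eigenvector: the
  nonnegative quadratic form \<open>q\<close> vanishes at it, so its first variation in the direction of the
  residual \<open>r\<close>, which is the squared norm of \<open>r\<close>, must vanish as well.\<close>

lemma self_adjoint_eigenvector:
  fixes f :: "'a::euclidean_space \<Rightarrow> 'a"
  assumes lin: "linear f" and adj: "\<And>x y. f x \<bullet> y = x \<bullet> f y"
    and S: "subspace S" "f ` S \<subseteq> S" "S \<noteq> {0}"
  obtains x l where "x \<in> S" "norm x = 1" "f x = l *\<^sub>R x"
proof -
  obtain z where z: "z \<in> S" "z \<noteq> 0" using S(1,3) subspace_0 by blast
  have "sgn z \<in> S \<inter> sphere 0 1"
    using z S(1) by (auto simp: sgn_div_norm subspace_scale)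
  moreover have "compact (S \<inter> sphere 0 1)"
    using closed_subspace[OF S(1)] by (intro closed_Int_compact) auto
  moreover have "continuous_on (S \<inter> sphere 0 1) (\<lambda>x. f x \<bullet> x)"
    using linear_continuous_on[OF linear_conv_bounded_linear[THEN iffD1, OF lin]]
    by (intro continuous_intros) auto
  ultimately obtain x where x: "x \<in> S" "norm x = 1"
    and max: "\<And>y. y \<in> S \<Longrightarrow> norm y = 1 \<Longrightarrow> f y \<bullet> y \<le> f x \<bullet> x"
    using continuous_attains_sup[of "S \<inter> sphere 0 1" "\<lambda>x. f x \<bullet> x"]
    by (metis IntE IntI empty_iff mem_sphere_0)
  define l where "l = f x \<bullet> x"
  define q where "q y = l * (y \<bullet> y) - f y \<bullet> y" for y
  have q: "q y \<ge> 0" if "y \<in> S" for y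
  proof (cases "y = 0")
    case False
    have "f (sgn y) \<bullet> sgn y \<le> l"
      unfolding l_def using that False S(1)
      by (intro max) (auto simp: sgn_div_norm subspace_scale)
    also have "f (sgn y) \<bullet> sgn y = (f y \<bullet> y) / (y \<bullet> y)"
      by (simp add: sgn_div_norm linear_cmul[OF lin] field_simps power2_norm_eq_inner[symmetric] power2_eq_square)
    finally show ?thesis using False by (simp add: q_def field_simps)
  qed (simp add: q_def linear_0[OF lin])
  define r where "r = l *\<^sub>R x - f x"
  have r: "r \<in> S" using S(1,2) x(1) by (auto simp: r_def intro!: subspace_diff subspace_scale)
  define b where "b = r \<bullet> r"
  have expand: "q (x + t *\<^sub>R r) = 2 * t * b + t\<^sup>2 * q r" for t
  proof -
    have "q x = 0" using x(2) by (simp add: q_def l_def power2_norm_eq_inner[symmetric])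
    then have "q (x + t *\<^sub>R r) = t * (l * (x \<bullet> r) + l * (r \<bullet> x) - f x \<bullet> r - f r \<bullet> x) + t\<^sup>2 * q r"
      unfolding q_def
      by (simp add: linear_add[OF lin] linear_cmul[OF lin] inner_simps algebra_simps power2_eq_square)
    also have "f r \<bullet> x = f x \<bullet> r" using adj[of r x] by (simp add: inner_commute)
    also have "r \<bullet> x = x \<bullet> r" by (simp add: inner_commute)
    also have "l * (x \<bullet> r) + l * (x \<bullet> r) - f x \<bullet> r - f x \<bullet> r = 2 * b"
      using inner_commute[of x "f x"] by (simp add: b_def r_def inner_simps algebra_simps)
    finally show ?thesis by simp
  qed
  have "b = 0"
  proof (rule ccontr)
    assume "b \<noteq> 0"
    have q0: "q r \<ge> 0" using q r by blast
    \<comment> \<open>The 1 avoids a division by zero; apart from it this is the minimizer of the parabola in \<open>t\<close>.\<close>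
    define t where "t = - b / (q r + 1)"
    have "x + t *\<^sub>R r \<in> S" using S(1) x(1) r by (intro subspace_add subspace_scale)
    from q[OF this] have "0 \<le> 2 * t * b + t\<^sup>2 * q r" by (simp add: expand)
    also have "\<dots> = - (b\<^sup>2 * (q r + 2)) / (q r + 1)\<^sup>2"
      using q0 by (simp add: t_def divide_simps power2_eq_square) (simp add: algebra_simps)
    also have "\<dots> < 0" using \<open>b \<noteq> 0\<close> q0 by (simp add: divide_neg_pos)
    finally show False by simp
  qed
  then have "f x = l *\<^sub>R x" by (simp add: b_def r_def)
  with x show ?thesis by (rule that)
qed

definition orthonormal :: "'a::euclidean_space set \<Rightarrow> bool"
  where "orthonormal B \<longleftrightarrow> finite B \<and> pairwise orthogonal B \<and> (\<forall>u\<in>B. norm u = 1)"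

lemma orthonormal_inner:
  assumes "orthonormal B" "u \<in> B" "u' \<in> B"
  shows "u \<bullet> u' = (if u = u' then 1 else 0)"
  using assms by (auto simp: orthonormal_def pairwise_def orthogonal_def power2_norm_eq_inner[symmetric])

lemma orthonormal_independent: "orthonormal B \<Longrightarrow> independent B"
  unfolding orthonormal_def by (metis norm_zero pairwise_orthogonal_independent zero_neq_one)

lemma orthonormal_expand:
  assumes "orthonormal B" "x \<in> span B"
  shows "(\<Sum>u\<in>B. (u \<bullet> x) *\<^sub>R u) = x"
  using assms orthonormal_basis_expand[of B x] unfolding orthonormal_def
  by (simp add: inner_commute)

lemma parseval:
  assumes "orthonormal B" "x \<in> span B"
  shows "(\<Sum>u\<in>B. (u \<bullet> x)\<^sup>2) = (norm x)\<^sup>2"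
proof -
  have "(norm x)\<^sup>2 = (\<Sum>u\<in>B. (u \<bullet> x) *\<^sub>R u) \<bullet> x"
    by (simp add: orthonormal_expand[OF assms] power2_norm_eq_inner)
  also have "\<dots> = (\<Sum>u\<in>B. (u \<bullet> x)\<^sup>2)"
    by (simp add: inner_sum_left power2_eq_square)
  finally show ?thesis by simp
qed

text \<open>The spectral theorem on an invariant subspace, by splitting off one eigenvector at a time.
  The relative form is needed because the eigenbasis of the Laplacian has to be adapted to the
  subspace of vectors that are constant on cells.\<close>

lemma self_adjoint_orthonormal_eigenbasis:
  fixes f :: "'a::euclidean_space \<Rightarrow> 'a"
  assumes lin: "linear f" and adj: "\<And>x y. f x \<bullet> y = x \<bullet> f y"
    and "subspace S" "f ` S \<subseteq> S"
  obtains B where "orthonormal B" "span B = S" "\<And>u. u \<in> B \<Longrightarrow> f u = (f u \<bullet> u) *\<^sub>R u"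
proof -
  have "\<exists>B. orthonormal B \<and> span B = S \<and> (\<forall>u\<in>B. f u = (f u \<bullet> u) *\<^sub>R u)"
    using assms(3,4)
  proof (induction "dim S" arbitrary: S rule: less_induct)
    case less
    show ?case
    proof (cases "S = {0}")
      case True
      then show ?thesis by (intro exI[of _ "{}"]) (auto simp: orthonormal_def)
    next
      case False
      obtain x l where x: "x \<in> S" "norm x = 1" "f x = l *\<^sub>R x"
        using self_adjoint_eigenvector[OF lin adj less.prems False] by metis
      have xx: "x \<bullet> x = 1" using x(2) by (simp add: power2_norm_eq_inner[symmetric])
      define T where "T = {y \<in> S. x \<bullet> y = 0}"
      have T: "subspace T"
        using less.prems(1) by (auto simp: T_def subspace_def inner_simps)
      moreover have "f ` T \<subseteq> T"
        using less.prems(2) adj[of x, symmetric] x(3) by (auto simp: T_def)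
      moreover have "dim T < dim S"
      proof -
        have "x \<notin> T" using xx by (simp add: T_def)
        moreover have "T \<subseteq> S" by (auto simp: T_def)
        ultimately have "T \<subset> S" using x(1) by blast
        then show ?thesis using dim_psubset[of T S] T less.prems(1) by (metis span_eq_iff)
      qed
      ultimately obtain B where B: "orthonormal B" "span B = T" "\<forall>u\<in>B. f u = (f u \<bullet> u) *\<^sub>R u"
        using less.hyps by blast
      have BT: "B \<subseteq> T" using B(2) span_superset by blast
      have "orthonormal (insert x B)"
        using B(1) BT x(2) unfolding orthonormal_def
        by (auto simp: pairwise_insert T_def orthogonal_def inner_commute)
      moreover have "span (insert x B) = S"
      proof
        show "span (insert x B) \<subseteq> S"
          using BT x(1) less.prems(1) by (intro span_minimal) (auto simp: T_def)
        show "S \<subseteq> span (insert x B)"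
        proof
          fix y assume "y \<in> S"
          then have "y - (x \<bullet> y) *\<^sub>R x \<in> T"
            using x(1) xx less.prems(1) by (auto simp: T_def inner_simps intro!: subspace_diff subspace_scale)
          then show "y \<in> span (insert x B)"
            unfolding span_insert using B(2) by blast
        qed
      qed
      moreover have "f x = (f x \<bullet> x) *\<^sub>R x" by (simp add: x(3) xx)
      ultimately show ?thesis using B(3) by (intro exI[of _ "insert x B"]) auto
    qed
  qed
  then show ?thesis using that by blast
qed

text \<open>Let \<open>T\<close> have the eigenvectors as columns. Over the polynomial ring, \<open>(x I - X) T = T (x I - D)\<close>
  with \<open>D\<close> diagonal, and taking determinants identifies the characteristic polynomial. The
  vectors \<open>y u\<close> carry an arbitrary index \<open>u\<close>, so that the Laplacian and its quotient
  can both be described by the same eigenvectors of the Laplacian.\<close>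

lemma spectrum_eigenbasis:
  fixes X :: "real ^ 'a ^ 'a" and y :: "'i \<Rightarrow> real ^ 'a"
  assumes "finite B" "inj_on y B" "independent (y ` B)" "card B = CARD('a)"
    and eig: "\<And>u. u \<in> B \<Longrightarrow> X *v y u = ev u *\<^sub>R y u"
  shows "spectrum X = image_mset ev (mset_set B)"
proof -
  obtain h :: "'a \<Rightarrow> 'i" where h: "bij_betw h UNIV B"
    using finite_same_card_bij[of "UNIV :: 'a set" B] assms by auto
  define k where "k = y \<circ> h"
  have k: "inj k" "range k = y ` B"
    using h assms(2) comp_inj_on[of h UNIV y] by (auto simp: k_def bij_betw_def image_comp[symmetric])
  have eig': "X *v k j = ev (h j) *\<^sub>R k j" for j
    using eig[of "h j"] h by (auto simp: k_def bij_betw_def)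
  define T :: "real ^ 'a ^ 'a" where "T = (\<chi> i j. k j $ i)"
  have col: "column j T = k j" for j by (simp add: column_def T_def)
  have "c j = 0" if "(\<Sum>j\<in>UNIV. c j *s column j T) = 0" for c j
  proof -
    have "(\<Sum>x\<in>range k. c (inv k x) *\<^sub>R x) = 0"
      using that k(1) by (simp add: sum.reindex col scalar_mult_eq_scaleR)
    then have "c (inv k (k j)) = 0"
      using assms(3) k(2) independentD[of "y ` B" "range k" "\<lambda>x. c (inv k x)" "k j"] assms(1) by auto
    then show ?thesis using k(1) by simp
  qed
  then have "\<exists>T'. T' ** T = mat 1"
    using matrix_left_invertible_independent_columns by blast
  then have "det T \<noteq> 0"
    using invertible_left_inverse invertible_det_nz by blast
  define lin :: "real ^ 'a ^ 'a \<Rightarrow> real poly ^ 'a ^ 'a"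
    where "lin Y = (\<chi> i j. (if i = j then [:0, 1:] else 0) - [:Y $ i $ j:])" for Y
  define cT :: "real poly ^ 'a ^ 'a" where "cT = (\<chi> i j. [:T $ i $ j:])"
  define D :: "real ^ 'a ^ 'a" where "D = (\<chi> i j. if i = j then ev (h i) else 0)"
  have "lin X ** cT = cT ** lin D"
  proof -
    have c: "(\<Sum>k\<in>K. [:p k:]) = [:\<Sum>k\<in>K. p k:]" for p :: "'a \<Rightarrow> real" and K
      by (induction K rule: infinite_finite_induct) auto
    have XT: "(\<Sum>k\<in>UNIV. X $ i $ k * T $ k $ j) = T $ i $ j * ev (h j)" for i j
      using eig'[of j] by (simp add: vec_eq_iff matrix_vector_mult_def T_def mult.commute)
    have 1: "(lin X ** cT) $ i $ j = [:0, 1:] * [:T $ i $ j:] - [:T $ i $ j * ev (h j):]" for i j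
    proof -
      have "(lin X ** cT) $ i $ j =
        (\<Sum>k\<in>UNIV. (if i = k then [:0, 1:] * [:T $ k $ j:] else 0) - [:X $ i $ k * T $ k $ j:])"
        unfolding matrix_matrix_mult_def lin_def cT_def vec_lambda_beta
        by (intro sum.cong refl) (auto simp: algebra_simps)
      then show ?thesis by (simp only: sum_subtractf c XT) simp
    qed
    have 2: "(cT ** lin D) $ i $ j = [:0, 1:] * [:T $ i $ j:] - [:T $ i $ j * ev (h j):]" for i j
    proof -
      have "(cT ** lin D) $ i $ j =
        (\<Sum>k\<in>UNIV. if k = j then [:0, 1:] * [:T $ i $ k:] - [:T $ i $ k * ev (h k):] else 0)"
        unfolding matrix_matrix_mult_def lin_def cT_def D_def vec_lambda_beta
        by (intro sum.cong refl) (auto simp: algebra_simps)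
      then show ?thesis by simp
    qed
    show ?thesis by (simp add: vec_eq_iff 1 2)
  qed
  then have "det (lin X) * det cT = det cT * det (lin D)"
    by (metis det_mul)
  moreover have "poly (det cT) 0 = det T"
    unfolding poly_det cT_def by (rule arg_cong[where f = det]) (simp add: vec_eq_iff)
  then have "det cT \<noteq> 0" using \<open>det T \<noteq> 0\<close> by auto
  ultimately have "charpoly X = det (lin D)" by (simp add: charpoly_def lin_def)
  also have "\<dots> = (\<Prod>i\<in>UNIV. [:- ev (h i), 1:])"
    by (subst det_diagonal) (auto simp: lin_def D_def)
  finally have "charpoly X = (\<Prod>i\<in>UNIV. [:- ev (h i), 1:])" .
  then have "spectrum X = (\<Sum>i\<in>UNIV. {#ev (h i)#})"
    unfolding spectrum_def by (simp add: proots_prod)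
  also have "\<dots> = image_mset ev (image_mset h (mset_set UNIV))"
    by (simp add: sum_unfold_sum_mset multiset.map_comp comp_def)
  also have "image_mset h (mset_set UNIV) = mset_set B"
    using h by (metis bij_betw_def image_mset_mset_set)
  finally show ?thesis .
qed

section \<open>The Laplacian and synchronization\<close>

lemma laplacian_symmetric:
  assumes "weighted_graph a"
  shows "transpose (laplacian a) = laplacian a"
  using assms by (auto simp: vec_eq_iff transpose_def laplacian_def weighted_graph_def)

lemma laplacian_mult:
  fixes a :: "real ^ 'v ^ 'v" and u :: "real ^ 'v"
  assumes "weighted_graph a"
  shows "(laplacian a *v u) $ i = (\<Sum>j\<in>UNIV. a $ i $ j * (u $ i - u $ j))"
proof -
  have "(laplacian a *v u) $ i =
      (\<Sum>j\<in>UNIV. (if i = j then (\<Sum>l\<in>UNIV. a $ i $ l) * u $ i else 0) - a $ i $ j * u $ j)"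
    using assms unfolding matrix_vector_mult_def laplacian_def
    by (auto simp: weighted_graph_def intro!: sum.cong)
  then show ?thesis
    by (simp add: sum_subtractf right_diff_distrib sum_distrib_right)
qed

lemma laplacian_const: "weighted_graph a \<Longrightarrow> laplacian a *v (\<chi> i. c) = 0"
  by (simp add: vec_eq_iff laplacian_mult)

text \<open>The quadratic form of the Laplacian is the sum of \<open>a\<^sub>i\<^sub>j (u\<^sub>i - u\<^sub>j)\<^sup>2\<close> up to the factor 2, so \<open>u\<close> agrees at
  the ends of each edge and hence along each path.\<close>

lemma laplacian_kernel:
  fixes a :: "real ^ 'v ^ 'v" and u :: "real ^ 'v"
  assumes a: "weighted_graph a" "graph_connected a" and u: "laplacian a *v u = 0"
  shows "u $ i = u $ j"
proof -
  have pos: "0 \<le> a $ i $ j * (u $ i - u $ j)\<^sup>2" for i j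
    using a by (simp add: weighted_graph_def)
  let ?Q = "\<Sum>i\<in>UNIV. \<Sum>j\<in>UNIV. a $ i $ j * (u $ i - u $ j) * u $ i"
  have "?Q = (\<Sum>i\<in>UNIV. (laplacian a *v u) $ i * u $ i)"
    by (simp add: laplacian_mult[OF a(1)] sum_distrib_right)
  then have Q: "?Q = 0" by (simp add: u)
  have "?Q = (\<Sum>i\<in>UNIV. \<Sum>j\<in>UNIV. a $ j $ i * (u $ j - u $ i) * u $ j)"
    by (rule sum.swap)
  also have "\<dots> = (\<Sum>i\<in>UNIV. \<Sum>j\<in>UNIV. a $ i $ j * (u $ j - u $ i) * u $ j)"
    using a(1) by (simp add: weighted_graph_def)
  finally have Q': "(\<Sum>i\<in>UNIV. \<Sum>j\<in>UNIV. a $ i $ j * (u $ j - u $ i) * u $ j) = 0" using Q by simp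
  have "(\<Sum>i\<in>UNIV. \<Sum>j\<in>UNIV. a $ i $ j * (u $ i - u $ j)\<^sup>2) =
    ?Q + (\<Sum>i\<in>UNIV. \<Sum>j\<in>UNIV. a $ i $ j * (u $ j - u $ i) * u $ j)"
    unfolding sum.distrib[symmetric] by (intro sum.cong refl) (simp add: power2_eq_square algebra_simps)
  then have "(\<Sum>i\<in>UNIV. \<Sum>j\<in>UNIV. a $ i $ j * (u $ i - u $ j)\<^sup>2) = 0"
    using Q Q' by simp
  then have z: "a $ i $ j * (u $ i - u $ j)\<^sup>2 = 0" for i j
    using pos by (simp add: sum_nonneg_eq_0_iff sum_nonneg)
  have edge: "u $ i = u $ j" if "a $ i $ j > 0" for i j
    using z[of i j] that by simp
  have "(i, j) \<in> {(p, q). a $ p $ q > 0}\<^sup>*"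
    using a(2) by (simp add: graph_connected_def)
  then show ?thesis
    by (induction rule: rtrancl_induct) (auto dest: edge)
qed

text \<open>An eigenvector \<open>u\<close> of the Laplacian and an eigenvector \<open>z\<close> of the corresponding modal matrix
  combine to the solution given by the real part of \<open>exp (s t) (u \<otimes> z)\<close>.\<close>

lemma network_modal_solution:
  fixes L :: "real ^ 'v ^ 'v" and A B :: "real ^ 'n ^ 'n" and z :: "complex ^ 'n"
  assumes u: "L *v u = l *\<^sub>R u" and z: "cmat (A - l *\<^sub>R B) *v z = s *s z"
  defines "x \<equiv> \<lambda>t. (\<chi> p. u $ fst p * Re (exp (s * of_real t) * z $ snd p)) :: real ^ ('v \<times> 'n)"
  shows "(x has_vector_derivative network_matrix L A B *v x t) (at t within S)"
proof -
  define \<Phi> where "\<Phi> w = ((\<chi> p. u $ fst p * Re (w * z $ snd p)) :: real ^ ('v \<times> 'n))" for w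
  have "linear \<Phi>"
    by (intro linearI) (auto simp: \<Phi>_def vec_eq_iff algebra_simps)
  then have bl: "bounded_linear \<Phi>" by (simp add: linear_conv_bounded_linear)
  have "((\<lambda>t. exp (s * of_real t)) has_vector_derivative s * exp (s * of_real t)) (at t within S)"
    by (rule has_vector_derivative_real_field) (auto intro!: derivative_eq_intros)
  from bounded_linear.has_vector_derivative[OF bl this]
  have "(x has_vector_derivative \<Phi> (s * exp (s * of_real t))) (at t within S)"
    by (simp only: x_def \<Phi>_def)
  also have "\<Phi> (s * exp (s * of_real t)) = network_matrix L A B *v x t"
  proof -
    define e where "e = exp (s * of_real t)"
    have "(network_matrix L A B *v x t) $ (i, \<sigma>) = \<Phi> (s * e) $ (i, \<sigma>)" for i \<sigma>
    proof -
      have Lu: "(\<Sum>j\<in>UNIV. L $ i $ j * u $ j) = l * u $ i"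
        using u by (simp add: vec_eq_iff matrix_vector_mult_def)
      have zs: "(\<Sum>\<tau>\<in>UNIV. (of_real (A $ \<sigma> $ \<tau>) - of_real l * of_real (B $ \<sigma> $ \<tau>)) * z $ \<tau>) = s * z $ \<sigma>"
        using z by (simp add: vec_eq_iff matrix_vector_mult_def cmat_def)
      have "(network_matrix L A B *v x t) $ (i, \<sigma>) =
        (\<Sum>j\<in>UNIV. \<Sum>\<tau>\<in>UNIV. ((if i = j then 1 else 0) * A $ \<sigma> $ \<tau> - L $ i $ j * B $ \<sigma> $ \<tau>) * (u $ j * Re (e * z $ \<tau>)))"
        by (simp add: matrix_vector_mult_def network_matrix_def kron_def mat_def x_def e_def
            sum.cartesian_product UNIV_Times_UNIV[symmetric] case_prod_beta del: UNIV_Times_UNIV)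
      also have "\<dots> = (\<Sum>\<tau>\<in>UNIV. \<Sum>j\<in>UNIV. (if i = j then u $ j * A $ \<sigma> $ \<tau> * Re (e * z $ \<tau>) else 0)
          - (L $ i $ j * u $ j) * (B $ \<sigma> $ \<tau> * Re (e * z $ \<tau>)))"
        by (subst sum.swap) (intro sum.cong refl, auto simp: algebra_simps)
      also have "\<dots> = (\<Sum>\<tau>\<in>UNIV. u $ i * A $ \<sigma> $ \<tau> * Re (e * z $ \<tau>) - (l * u $ i) * (B $ \<sigma> $ \<tau> * Re (e * z $ \<tau>)))"
        by (simp only: sum_subtractf sum_distrib_right[symmetric] Lu) simp
      also have "\<dots> = u $ i * Re (\<Sum>\<tau>\<in>UNIV. e * ((of_real (A $ \<sigma> $ \<tau>) - of_real l * of_real (B $ \<sigma> $ \<tau>)) * z $ \<tau>))"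
        unfolding Re_sum sum_distrib_left by (intro sum.cong refl) (simp add: algebra_simps)
      also have "\<dots> = u $ i * Re (e * (s * z $ \<sigma>))"
        by (simp only: sum_distrib_left[symmetric] zs)
      finally show ?thesis by (simp add: \<Phi>_def mult_ac)
    qed
    then show ?thesis by (simp add: vec_eq_iff e_def)
  qed
  finally show ?thesis .
qed

text \<open>If \<open>A - l B\<close> had an eigenvalue \<open>s\<close> in the closed right half plane, then the modal
  solutions for \<open>z\<close> and for \<open>- \<i> z\<close> would carry the real and the imaginary part of
  \<open>exp (s t) z\<close>, which does not decay. As \<open>u\<close> belongs to a nonzero eigenvalue, it is not constant,
  so two agents would fail to synchronize.\<close>

lemma synchronized_imp_hurwitz:
  fixes a :: "real ^ 'v ^ 'v" and A B :: "real ^ 'n ^ 'n"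
  assumes a: "weighted_graph a" and sync: "synchronized a A B"
    and u: "laplacian a *v u = l *\<^sub>R u" "u \<noteq> 0" "l \<noteq> 0"
  shows "hurwitz (A - l *\<^sub>R B)"
  unfolding hurwitz_def
proof (intro allI impI, rule ccontr)
  fix s :: complex
  assume s: "0 \<le> Re s" "\<not> invertible (mat s - cmat (A - l *\<^sub>R B))"
  then obtain z where z: "z \<noteq> 0" "cmat (A - l *\<^sub>R B) *v z = s *s z"
    using not_invertible_eigenvector by blast
  obtain i j where ij: "u $ i \<noteq> u $ j"
  proof (rule ccontr)
    assume "\<not> thesis"
    then have "u = (\<chi> i. u $ undefined)" using that by (auto simp: vec_eq_iff)
    then have "laplacian a *v u = 0" using laplacian_const[OF a] by metis
    with u show False by simp
  qed
  have decay: "((\<lambda>t. Re (exp (s * of_real t) * y $ \<sigma>)) \<longlongrightarrow> 0) at_top"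
    if y: "cmat (A - l *\<^sub>R B) *v y = s *s y" for y :: "complex ^ 'n" and \<sigma>
  proof -
    define x where "x = (\<lambda>t. (\<chi> p. u $ fst p * Re (exp (s * of_real t) * y $ snd p)) :: real ^ ('v \<times> 'n))"
    have "(x has_vector_derivative network_matrix (laplacian a) A B *v x t) (at t within {0..})" for t
      unfolding x_def by (rule network_modal_solution[OF u(1) y])
    then have "((\<lambda>t. block (x t) i - block (x t) j) \<longlongrightarrow> 0) at_top"
      using sync unfolding synchronized_def by blast
    from tendsto_vec_nth[OF this, of \<sigma>]
    have "((\<lambda>t. (u $ i - u $ j) * Re (exp (s * of_real t) * y $ \<sigma>)) \<longlongrightarrow> 0) at_top"
      by (simp add: block_def x_def algebra_simps)
    from tendsto_mult_left[OF this, of "1 / (u $ i - u $ j)"] show ?thesis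
      using ij by simp
  qed
  obtain \<sigma> where \<sigma>: "z $ \<sigma> \<noteq> 0" using z(1) by (auto simp: vec_eq_iff)
  have iz: "cmat (A - l *\<^sub>R B) *v (\<chi> k. - \<i> * z $ k) = s *s (\<chi> k. - \<i> * z $ k)"
  proof -
    have "(\<Sum>j\<in>UNIV. cmat (A - l *\<^sub>R B) $ i $ j * z $ j) = s * z $ i" for i
      using z(2) by (simp add: vec_eq_iff matrix_vector_mult_def)
    then have "- \<i> * (\<Sum>j\<in>UNIV. cmat (A - l *\<^sub>R B) $ i $ j * z $ j) = - \<i> * (s * z $ i)" for i
      by metis
    then show ?thesis
      by (simp add: vec_eq_iff matrix_vector_mult_def sum_distrib_left sum_negf mult_ac)
  qed
  have "((\<lambda>t. Im (exp (s * of_real t) * z $ \<sigma>)) \<longlongrightarrow> 0) at_top"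
    using decay[OF iz, of \<sigma>] by (simp add: algebra_simps)
  with decay[OF z(2), of \<sigma>] have "((\<lambda>t. exp (s * of_real t) * z $ \<sigma>) \<longlongrightarrow> 0) at_top"
    by (simp add: tendsto_complex_iff)
  then have lim: "((\<lambda>t. norm (exp (s * of_real t) * z $ \<sigma>)) \<longlongrightarrow> 0) at_top"
    by (simp add: tendsto_norm_zero)
  have "eventually (\<lambda>t. norm (z $ \<sigma>) \<le> norm (exp (s * of_real t) * z $ \<sigma>)) at_top"
    using eventually_ge_at_top[of 0]
  proof eventually_elim
    case (elim t)
    have "1 \<le> exp (Re s * t)" using s(1) elim by simp
    then show ?case by (simp add: norm_mult mult_le_cancel_right1)
  qed
  then have "norm (z $ \<sigma>) \<le> 0" by (rule tendsto_lowerbound[OF lim]) simp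
  with \<sigma> show False by simp
qed

section \<open>Modal decomposition of the network\<close>

definition rank_one :: "real ^ 'v \<Rightarrow> real ^ 'v ^ 'v"
  where "rank_one u = (\<chi> i j. u $ i * u $ j)"

text \<open>Resolution of the identity for an orthonormal basis.\<close>

lemma sum_rank_one:
  fixes U :: "(real ^ 'v) set"
  assumes "orthonormal U" "span U = UNIV"
  shows "(\<Sum>u\<in>U. rank_one u) = mat 1"
proof -
  have "(\<Sum>u\<in>U. u $ i * u $ j) = (if i = j then 1 else 0)" for i j
  proof -
    have "(\<Sum>u\<in>U. (u \<bullet> axis i 1) *\<^sub>R u) $ j = (axis i 1 :: real ^ 'v) $ j"
      using orthonormal_expand[OF assms(1)] assms(2) by simp
    then show ?thesis by (simp add: inner_axis) (auto simp: axis_def)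
  qed
  then show ?thesis by (simp add: vec_eq_iff rank_one_def mat_def)
qed

lemma rank_one_eigenvector:
  assumes "L *v u = l *\<^sub>R u"
  shows "L ** rank_one u = l *\<^sub>R rank_one u"
  using assms
  by (simp add: vec_eq_iff rank_one_def matrix_matrix_mult_def matrix_vector_mult_def
      mult.assoc[symmetric] sum_distrib_right[symmetric])

lemma trace_rank_one_mult:
  fixes W :: "real ^ 'm ^ 'v"
  shows "trace (transpose (rank_one u ** W) ** (rank_one u' ** W)) =
    (u \<bullet> u') * (\<Sum>j\<in>UNIV. (u \<bullet> column j W) * (u' \<bullet> column j W))"
proof -
  have r: "(rank_one u ** W) $ i $ j = u $ i * (u \<bullet> column j W)" for u :: "real ^ 'v" and i j
    by (simp add: rank_one_def matrix_matrix_mult_def inner_vec_def column_def sum_distrib_left mult.assoc)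
  have "(transpose X ** Y) $ j $ j = (\<Sum>i\<in>UNIV. X $ i $ j * Y $ i $ j)" for X Y :: "real ^ 'm ^ 'v" and j
    by (simp add: matrix_matrix_mult_def transpose_def)
  then show ?thesis
    by (simp add: trace_def r) (simp add: inner_vec_def[of u u'] sum_distrib_left sum_distrib_right
      mult_ac sum.swap[of _ "UNIV :: 'm set"])
qed

text \<open>In this form the auxiliary system of the eigenvalue 0 visibly vanishes, so the agent dynamics
  \<open>A\<close>, which need not be stable, never contributes.\<close>

lemma aux_tf_alt:
  "aux_tf A B E l s = l *\<^sub>R (matrix_inv (mat s - cmat (A - l *\<^sub>R B)) ** cmat E)"
proof -
  have "cmat (mat l) ** X = l *\<^sub>R X" for X :: "complex ^ 'q ^ 'p"
    unfolding cmat_mat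
    by (simp add: vec_eq_iff matrix_matrix_mult_def mat_def if_distrib if_distribR cong: if_cong)
      (simp add: scaleR_conv_of_real)
  then show ?thesis
    by (simp add: aux_tf_def transfer_function_def matrix_mul_assoc[symmetric])
qed

lemma cmat_network_matrix:
  "cmat (network_matrix L A B) = kron (mat 1) (cmat A) - kron (cmat L) (cmat B)"
  by (simp add: network_matrix_def cmat_diff cmat_kron cmat_mat)

lemma mat_pair: "(mat s :: 'a::semiring_1 ^ ('p::finite \<times> 'q::finite) ^ ('p \<times> 'q)) = kron (mat 1) (mat s)"
  by (simp add: kron_mat_mat)

text \<open>The network matrix acts on the range of \<open>u u\<^sup>T \<otimes> I\<close> as \<open>A - ev u B\<close>, so its resolvent is the
  sum of the modal resolvents.\<close>

lemma network_resolvent: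
  fixes L :: "real ^ 'v ^ 'v" and A B :: "real ^ 'n ^ 'n"
  assumes U: "orthonormal U" "span U = UNIV"
    and eig: "\<And>u. u \<in> U \<Longrightarrow> L *v u = ev u *\<^sub>R u"
    and inv: "\<And>u. u \<in> U \<Longrightarrow> invertible (mat s - cmat (A - ev u *\<^sub>R B))"
  shows "matrix_inv (mat s - cmat (network_matrix L A B)) =
    (\<Sum>u\<in>U. kron (cmat (rank_one u)) (matrix_inv (mat s - cmat (A - ev u *\<^sub>R B))))"
proof (rule matrix_inv_eqI)
  have "(mat s - cmat (network_matrix L A B)) **
      kron (cmat (rank_one u)) (matrix_inv (mat s - cmat (A - ev u *\<^sub>R B))) =
      kron (cmat (rank_one u)) (mat 1)" if u: "u \<in> U" for u
  proof -
    let ?R = "matrix_inv (mat s - cmat (A - ev u *\<^sub>R B))" and ?Q = "cmat (rank_one u)"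
    have LQ: "cmat L ** ?Q = ev u *\<^sub>R ?Q"
      using rank_one_eigenvector[OF eig[OF u]] by (metis cmat_mult cmat_scaleR)
    have "(mat s - cmat (network_matrix L A B)) ** kron ?Q ?R =
      kron ?Q (mat s ** ?R) - (kron ?Q (cmat A ** ?R) - kron (ev u *\<^sub>R ?Q) (cmat B ** ?R))"
      unfolding cmat_network_matrix mat_pair matrix_mul_diff_left kron_mult LQ by simp
    also have "\<dots> = kron ?Q ((mat s - cmat (A - ev u *\<^sub>R B)) ** ?R)"
      by (simp add: kron_scaleR_swap cmat_diff cmat_scaleR matrix_mul_diff_left
          matrix_mul_scaleR_left kron_diff_right)
    also have "\<dots> = kron ?Q (mat 1)" using matrix_inv_mult(1)[OF inv[OF u]] by simp
    finally show ?thesis .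
  qed
  then have "(mat s - cmat (network_matrix L A B)) **
    (\<Sum>u\<in>U. kron (cmat (rank_one u)) (matrix_inv (mat s - cmat (A - ev u *\<^sub>R B)))) =
    kron (cmat (\<Sum>u\<in>U. rank_one u)) (mat 1)"
    by (simp add: matrix_mul_sum_right cmat_sum kron_sum_left)
  then show "(mat s - cmat (network_matrix L A B)) **
    (\<Sum>u\<in>U. kron (cmat (rank_one u)) (matrix_inv (mat s - cmat (A - ev u *\<^sub>R B)))) = mat 1"
    by (simp add: sum_rank_one[OF U] cmat_mat kron_mat_mat)
qed

lemma network_modal_decomposition:
  fixes L :: "real ^ 'v ^ 'v" and A B :: "real ^ 'n ^ 'n" and W :: "real ^ 'm ^ 'v" and E :: "real ^ 'r ^ 'n"
  assumes U: "orthonormal U" "span U = UNIV"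
    and eig: "\<And>u. u \<in> U \<Longrightarrow> L *v u = ev u *\<^sub>R u"
    and inv: "\<And>u. u \<in> U \<Longrightarrow> invertible (mat s - cmat (A - ev u *\<^sub>R B))"
  shows "transfer_function (network_matrix L A B) (kron W E) (kron L (mat 1)) s =
    (\<Sum>u\<in>{u \<in> U. ev u \<noteq> 0}. kron (cmat (rank_one u ** W)) (aux_tf A B E (ev u) s))"
proof -
  have fin: "finite U" using U by (simp add: orthonormal_def)
  have mode: "kron (cmat L) (mat 1) ** kron (cmat (rank_one u)) (matrix_inv (mat s - cmat (A - ev u *\<^sub>R B)))
      ** kron (cmat W) (cmat E) = kron (cmat (rank_one u ** W)) (aux_tf A B E (ev u) s)" if u: "u \<in> U" for u
  proof -
    have LQ: "cmat L ** cmat (rank_one u) = ev u *\<^sub>R cmat (rank_one u)"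
      using rank_one_eigenvector[OF eig[OF u]] by (metis cmat_mult cmat_scaleR)
    show ?thesis
      by (simp add: kron_mult LQ matrix_mul_scaleR_left kron_scaleR_swap aux_tf_alt cmat_mult)
  qed
  have res: "matrix_inv (mat s - cmat (network_matrix L A B)) =
    (\<Sum>u\<in>U. kron (cmat (rank_one u)) (matrix_inv (mat s - cmat (A - ev u *\<^sub>R B))))"
    by (rule network_resolvent[OF U eig inv])
  have "transfer_function (network_matrix L A B) (kron W E) (kron L (mat 1)) s =
    (\<Sum>u\<in>U. kron (cmat (rank_one u ** W)) (aux_tf A B E (ev u) s))"
    unfolding transfer_function_def res cmat_kron cmat_mat of_real_1
      matrix_mul_sum_right matrix_mul_sum_left
    by (intro sum.cong refl mode)
  also have "\<dots> = (\<Sum>u\<in>{u \<in> U. ev u \<noteq> 0}. kron (cmat (rank_one u ** W)) (aux_tf A B E (ev u) s))"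
    using fin by (intro sum.mono_neutral_right) (auto simp: aux_tf_alt kron_def vec_eq_iff)
  finally show ?thesis .
qed

text \<open>Each mode \<open>u\<close> contributes independently, weighted by the energy with which the input matrix
  \<open>W\<close> excites it. Both the network and its reduction error are of this form, for different \<open>W\<close>.\<close>

lemma network_h2_norm:
  fixes L :: "real ^ 'v ^ 'v" and A B :: "real ^ 'n ^ 'n" and W :: "real ^ 'm ^ 'v" and E :: "real ^ 'r ^ 'n"
  assumes U: "orthonormal U" "span U = UNIV"
    and eig: "\<And>u. u \<in> U \<Longrightarrow> L *v u = ev u *\<^sub>R u"
    and hur: "\<And>u. u \<in> U \<Longrightarrow> ev u \<noteq> 0 \<Longrightarrow> hurwitz (A - ev u *\<^sub>R B)"
    and Z: "finite Z"
    and G: "\<And>s. s \<notin> Z \<Longrightarrow> G s = transfer_function (network_matrix L A B) (kron W E) (kron L (mat 1)) s"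
  shows "(h2_norm G)\<^sup>2 = (\<Sum>u\<in>{u \<in> U. ev u \<noteq> 0}.
    (\<Sum>j\<in>UNIV. (u \<bullet> column j W)\<^sup>2) * (h2_norm (aux_tf A B E (ev u)))\<^sup>2)"
proof -
  have fin: "finite U" using U by (simp add: orthonormal_def)
  define Z' where "Z' = Z \<union> (\<Union>u\<in>U. {s. \<not> invertible (mat s - cmat (A - ev u *\<^sub>R B))})"
  have aux: "aux_tf A B E l = transfer_function (A - l *\<^sub>R B) E (mat l)" for l
    by (simp add: fun_eq_iff aux_tf_def)
  show ?thesis
    unfolding aux
  proof (rule h2_norm_orthogonal_sum[where Z = Z' and X = "\<lambda>u. cmat (rank_one u ** W)"])
    show "finite Z'" unfolding Z'_def using fin Z by (simp add: finite_not_invertible_resolvent)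
    fix s assume "s \<notin> Z'"
    then show "G s = (\<Sum>u\<in>{u \<in> U. ev u \<noteq> 0}.
        kron (cmat (rank_one u ** W)) (transfer_function (A - ev u *\<^sub>R B) E (mat (ev u)) s))"
      using G network_modal_decomposition[OF U eig, of s A B W E] by (simp add: Z'_def aux)
  next
    fix u u' assume "u \<in> {u \<in> U. ev u \<noteq> 0}" "u' \<in> {u \<in> U. ev u \<noteq> 0}"
    then have uu: "u \<bullet> u' = (if u = u' then 1 else 0)" using orthonormal_inner[OF U(1)] by simp
    have tr: "trace (cmat X) = of_real (trace X)" for X :: "real ^ 'm ^ 'm"
      by (simp add: trace_def cmat_def)
    show "trace (transpose (cmat (rank_one u ** W)) ** cmat (rank_one u' ** W)) =
        (if u = u' then complex_of_real (\<Sum>j\<in>UNIV. (u \<bullet> column j W)\<^sup>2) else 0)"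
      unfolding cmat_transpose[symmetric] cmat_mult[symmetric] tr trace_rank_one_mult uu
      by (simp add: power2_eq_square)
  qed (use fin hur in \<open>auto intro: sum_nonneg\<close>)
qed

text \<open>If \<open>L P = P Lh\<close>, then \<open>P \<otimes> I\<close> intertwines the two network matrices and therefore their
  resolvents. Hence the reduced network is the original network driven through the input matrix
  \<open>P Mh\<close>.\<close>

lemma reduced_transfer_function:
  fixes L :: "real ^ 'v ^ 'v" and Lh :: "real ^ 'k ^ 'k" and P :: "real ^ 'k ^ 'v"
    and Mh :: "real ^ 'm ^ 'k" and A B :: "real ^ 'n ^ 'n" and E :: "real ^ 'r ^ 'n"
  assumes LP: "L ** P = P ** Lh"
    and inv: "invertible (mat s - cmat (network_matrix L A B))"
      "invertible (mat s - cmat (network_matrix Lh A B))"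
  shows "transfer_function (network_matrix Lh A B) (kron Mh E) (kron (L ** P) (mat 1)) s =
    transfer_function (network_matrix L A B) (kron (P ** Mh) E) (kron L (mat 1)) s"
proof -
  define K where "K = mat s - cmat (network_matrix L A B)"
  define Kh where "Kh = mat s - cmat (network_matrix Lh A B)"
  define Q :: "complex ^ ('k \<times> 'n) ^ ('v \<times> 'n)" where "Q = kron (cmat P) (mat 1)"
  have "K ** Q = Q ** Kh"
    unfolding K_def Kh_def Q_def cmat_network_matrix mat_pair matrix_mul_diff_left matrix_mul_diff_right
      kron_mult by (simp add: cmat_mult[symmetric] LP)
  then have "matrix_inv K ** (K ** Q) ** matrix_inv Kh = matrix_inv K ** (Q ** Kh) ** matrix_inv Kh"
    by simp
  then have "(matrix_inv K ** K) ** Q ** matrix_inv Kh = matrix_inv K ** Q ** (Kh ** matrix_inv Kh)"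
    by (simp only: matrix_mul_assoc)
  then have QK: "Q ** matrix_inv Kh = matrix_inv K ** Q"
    using inv by (simp add: matrix_inv_mult K_def Kh_def)
  have H: "cmat (kron (L ** P) (mat 1)) = cmat (kron L (mat 1)) ** Q"
    and G: "cmat (kron (P ** Mh) E) = Q ** cmat (kron Mh E)"
    by (simp_all add: Q_def cmat_kron cmat_mat cmat_mult kron_mult)
  show ?thesis
    unfolding transfer_function_def K_def[symmetric] Kh_def[symmetric] H G
    by (simp only: matrix_mul_assoc[symmetric] QK)
qed

lemma transfer_function_diff_input:
  "transfer_function F G H s - transfer_function F G' H s = transfer_function F (G - G') H s"
  by (simp add: transfer_function_def cmat_diff matrix_mul_diff_right)

section \<open>Almost equitable partitions\<close>

lemma char_matrix_mult:
  assumes "graph_partition C" "i \<in> C p"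
  shows "(char_matrix C *v x) $ i = x $ p"
proof -
  have "(i \<in> C q) = (p = q)" for q
    using assms by (auto simp: graph_partition_def disjoint_family_on_def)
  then show ?thesis
    by (simp add: matrix_vector_mult_def char_matrix_def if_distrib if_distribR cong: if_cong)
qed

lemma partition_cell:
  assumes "graph_partition C"
  obtains p where "i \<in> C p"
  using assms that unfolding graph_partition_def by blast

lemma char_matrix_const:
  assumes "graph_partition C"
  shows "char_matrix C *v (\<chi> p. r) = (\<chi> i. r)"
  unfolding vec_eq_iff
proof
  fix i
  obtain p where "i \<in> C p" using partition_cell[OF assms] .
  then show "(char_matrix C *v (\<chi> p. r)) $ i = (\<chi> i. r) $ i"
    by (simp add: char_matrix_mult[OF assms])
qed

lemma char_matrix_inj:
  assumes "graph_partition C" "char_matrix C *v x = 0"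
  shows "x = 0"
  unfolding vec_eq_iff
proof
  fix p
  obtain i where "i \<in> C p" using assms(1) unfolding graph_partition_def by blast
  from char_matrix_mult[OF assms(1) this, of x] show "x $ p = 0 $ p" by (simp add: assms(2))
qed

lemma invertible_gram_char_matrix:
  assumes "graph_partition C"
  shows "invertible (transpose (char_matrix C) ** char_matrix C)"
proof -
  let ?P = "char_matrix C"
  have "x = 0" if "(transpose ?P ** ?P) *v x = 0" for x
  proof (rule char_matrix_inj[OF assms])
    have "(?P *v x) \<bullet> (?P *v x) = x \<bullet> ((transpose ?P ** ?P) *v x)"
      by (simp only: matrix_vector_mul_assoc[symmetric] transpose_matrix_vector inner_commute[of x] dot_lmul_matrix)
    with that show "?P *v x = 0" by simp
  qed
  then show ?thesis
    using matrix_left_invertible_ker invertible_left_inverse by blast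
qed

text \<open>Almost equitability says that off-diagonal block sums of the Laplacian depend only on the
  cells; the diagonal ones follow since all rows sum to zero. So \<open>L P = P X\<close> for some \<open>X\<close>,
  and the pseudoinverse of \<open>P\<close> in the definition of the reduced Laplacian recovers \<open>X\<close>.\<close>

lemma almost_equitable_quotient:
  fixes C :: "'k::finite \<Rightarrow> 'v::finite set"
  assumes a: "weighted_graph a" and C: "graph_partition C" and ae: "almost_equitable a C"
  shows "laplacian a ** char_matrix C = char_matrix C ** red_laplacian a C"
proof -
  let ?L = "laplacian a" and ?P = "char_matrix C"
  have off: "(?L ** ?P) $ i $ p = - (\<Sum>j\<in>C p. a $ j $ i)" if "i \<notin> C p" for i p
  proof -
    have "(?L ** ?P) $ i $ p = (\<Sum>j\<in>C p. ?L $ i $ j)"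
      by (simp add: matrix_matrix_mult_def char_matrix_def if_distrib if_distribR sum.If_cases cong: if_cong)
    also have "\<dots> = (\<Sum>j\<in>C p. - (a $ j $ i))"
      using that a by (intro sum.cong) (auto simp: laplacian_def weighted_graph_def)
    finally show ?thesis by (simp add: sum_negf)
  qed
  have row: "(\<Sum>p\<in>UNIV. (?L ** ?P) $ i $ p) = 0" for i
  proof -
    have "(?L ** ?P) *v (\<chi> p. 1) = 0"
      by (simp add: matrix_vector_mul_assoc[symmetric] char_matrix_const[OF C] laplacian_const[OF a])
    then show ?thesis by (simp add: vec_eq_iff matrix_vector_mult_def)
  qed
  have notin: "i \<notin> C p" if "i \<in> C q" "p \<noteq> q" for i p q
    using C that by (auto simp: graph_partition_def disjoint_family_on_def)
  have eq_off: "(?L ** ?P) $ i $ p = (?L ** ?P) $ i' $ p" if "i \<in> C q" "i' \<in> C q" "p \<noteq> q" for i i' p q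
    using ae that off notin unfolding almost_equitable_def by metis
  have eq: "(?L ** ?P) $ i $ p = (?L ** ?P) $ i' $ p" if i: "i \<in> C q" "i' \<in> C q" for i i' p q
  proof (cases "p = q")
    case True
    have "(?L ** ?P) $ i $ q = - (\<Sum>p\<in>UNIV - {q}. (?L ** ?P) $ i $ p)" for i
      using row[of i] by (simp add: sum.remove[of UNIV q])
    moreover have "(\<Sum>p\<in>UNIV - {q}. (?L ** ?P) $ i $ p) = (\<Sum>p\<in>UNIV - {q}. (?L ** ?P) $ i' $ p)"
      using eq_off[OF i] by (intro sum.cong) auto
    ultimately show ?thesis using True by metis
  qed (use eq_off i in blast)
  define X where "X = (\<chi> q p. (?L ** ?P) $ (SOME i. i \<in> C q) $ p)"
  have LP: "?L ** ?P = ?P ** X"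
    unfolding vec_eq_iff
  proof (intro allI)
    fix i p
    obtain q where q: "i \<in> C q" using partition_cell[OF C] .
    then have some: "(SOME i. i \<in> C q) \<in> C q" by (rule someI)
    have "(?L ** ?P) $ i $ p = X $ q $ p"
      unfolding X_def vec_lambda_beta by (rule eq[OF q some])
    also have "\<dots> = (?P *v (\<chi> q. X $ q $ p)) $ i" using char_matrix_mult[OF C q] by simp
    also have "\<dots> = (?P ** X) $ i $ p" by (simp add: matrix_vector_mult_def matrix_matrix_mult_def)
    finally show "(?L ** ?P) $ i $ p = (?P ** X) $ i $ p" .
  qed
  have "red_laplacian a C = matrix_inv (transpose ?P ** ?P) ** (transpose ?P ** ?P) ** X"
    unfolding red_laplacian_def Let_def by (simp add: LP matrix_mul_assoc[symmetric])
  also have "\<dots> = X"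
    using matrix_inv_mult(2)[OF invertible_gram_char_matrix[OF C]] by simp
  finally show ?thesis by (simp add: LP)
qed

lemma symmetric_matrix_adjoint:
  fixes L :: "real ^ 'v ^ 'v"
  assumes "transpose L = L"
  shows "(L *v x) \<bullet> y = x \<bullet> (L *v y)"
proof -
  have "L *v x = x v* L" using transpose_matrix_vector[of L x] by (simp only: assms)
  then show ?thesis by (simp only: dot_lmul_matrix)
qed

lemma card_orthonormal_basis:
  "orthonormal B \<Longrightarrow> card B = dim (span B)"
  using orthonormal_independent by (metis dim_span dim_eq_card_independent)

text \<open>The orthogonal complement of an invariant subspace of a symmetric matrix is invariant.\<close>

lemma adapted_eigenbasis:
  fixes L :: "real ^ 'v ^ 'v"
  assumes sym: "transpose L = L" and S: "subspace S" "\<And>x. x \<in> S \<Longrightarrow> L *v x \<in> S"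
  obtains B1 B2 where "orthonormal (B1 \<union> B2)" "span (B1 \<union> B2) = UNIV" "B1 \<inter> B2 = {}"
    "span B1 = S" "\<And>u x. u \<in> B2 \<Longrightarrow> x \<in> S \<Longrightarrow> u \<bullet> x = 0"
    "\<And>u. u \<in> B1 \<union> B2 \<Longrightarrow> L *v u = ((L *v u) \<bullet> u) *\<^sub>R u"
proof -
  have adj: "(L *v x) \<bullet> y = x \<bullet> (L *v y)" for x y by (rule symmetric_matrix_adjoint[OF sym])
  have inv: "(*v) L ` S \<subseteq> S" using S(2) by blast
  obtain B1 where B1: "orthonormal B1" "span B1 = S" "\<And>u. u \<in> B1 \<Longrightarrow> L *v u = ((L *v u) \<bullet> u) *\<^sub>R u"
    by (rule self_adjoint_orthonormal_eigenbasis[OF matrix_vector_mul_linear adj S(1) inv]) blast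
  have inv': "(*v) L ` (S\<^sup>\<bottom>) \<subseteq> S\<^sup>\<bottom>"
  proof (rule image_subsetI)
    fix x assume x: "x \<in> S\<^sup>\<bottom>"
    have "y \<bullet> (L *v x) = 0" if "y \<in> S" for y
      using x S(2)[OF that] adj[of y x] by (simp add: orthogonal_comp_def orthogonal_def)
    then show "L *v x \<in> S\<^sup>\<bottom>" by (simp add: orthogonal_comp_def orthogonal_def)
  qed
  obtain B2 where B2: "orthonormal B2" "span B2 = S\<^sup>\<bottom>" "\<And>u. u \<in> B2 \<Longrightarrow> L *v u = ((L *v u) \<bullet> u) *\<^sub>R u"
    by (rule self_adjoint_orthonormal_eigenbasis[OF matrix_vector_mul_linear adj
          subspace_orthogonal_comp inv']) blast
  have perp: "u \<bullet> x = 0" if "u \<in> B2" "x \<in> S" for u x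
  proof -
    have "u \<in> S\<^sup>\<bottom>" using that(1) B2(2) span_base by blast
    with that(2) show ?thesis by (auto simp: orthogonal_comp_def orthogonal_def inner_commute)
  qed
  have B1S: "B1 \<subseteq> S" using B1(2) span_superset by blast
  have disj: "B1 \<inter> B2 = {}"
  proof (rule ccontr)
    assume "B1 \<inter> B2 \<noteq> {}"
    then obtain u where u: "u \<in> B1" "u \<in> B2" by blast
    then have "u \<bullet> u = 0" using perp B1S by blast
    with u B1(1) show False by (auto simp: orthonormal_def)
  qed
  have "orthonormal (B1 \<union> B2)"
    using B1(1) B2(1) perp B1S unfolding orthonormal_def pairwise_def
    by (auto simp: orthogonal_def) (metis inner_commute subsetD)+
  moreover have "span (B1 \<union> B2) = UNIV"
    using subspace_sum_orthogonal_comp[OF S(1)] by (simp add: span_Un B1(2) B2(2) set_plus_def) blast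
  ultimately show ?thesis
    using disj B1(2) perp B1(3) B2(3) by (intro that[of B1 B2]) auto
qed

lemma spectrum_orthonormal_eigenbasis:
  fixes L :: "real ^ 'v ^ 'v"
  assumes "orthonormal U" "span U = UNIV" "\<And>u. u \<in> U \<Longrightarrow> L *v u = ev u *\<^sub>R u"
  shows "spectrum L = image_mset ev (mset_set U)"
  using assms orthonormal_independent card_orthonormal_basis[OF assms(1)]
  by (intro spectrum_eigenbasis[where y = "\<lambda>u. u"]) (auto simp: orthonormal_def)

text \<open>The pseudoinverse \<open>P'\<close> of the characteristic matrix maps the eigenvectors of the Laplacian
  that are constant on cells to an eigenbasis of the reduced Laplacian. Since it is diagonalized in
  this way, its spectrum is known with multiplicities although it need not be symmetric.\<close>

lemma spectrum_red_laplacian: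
  fixes C :: "'k::finite \<Rightarrow> 'v::finite set"
  assumes C: "graph_partition C"
    and B: "orthonormal B" "span B = range ((*v) (char_matrix C))"
    and eig: "\<And>u. u \<in> B \<Longrightarrow> laplacian a *v u = ev u *\<^sub>R u"
  shows "spectrum (red_laplacian a C) = image_mset ev (mset_set B)"
proof -
  let ?P = "char_matrix C"
  define P' where "P' = matrix_inv (transpose ?P ** ?P) ** transpose ?P"
  have P'P: "P' ** ?P = mat 1"
    using matrix_inv_mult(2)[OF invertible_gram_char_matrix[OF C]]
    by (simp add: P'_def matrix_mul_assoc[symmetric])
  have PP': "?P *v (P' *v u) = u" if "u \<in> span B" for u
    using that B(2) P'P by (auto simp: matrix_vector_mul_assoc matrix_mul_assoc[symmetric])
  have inj: "inj_on ((*v) P') (span B)" using PP' by (metis inj_onI)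
  show ?thesis
  proof (rule spectrum_eigenbasis[where y = "(*v) P'"])
    show "finite B" using B(1) by (simp add: orthonormal_def)
    show "inj_on ((*v) P') B" using inj span_superset by (rule inj_on_subset)
    show "independent ((*v) P' ` B)"
      by (rule linear_independent_injective_image[OF _ orthonormal_independent[OF B(1)] inj]) simp
    have "inj ((*v) ?P)" using char_matrix_inj[OF C] by (simp add: linear_injective_0)
    then have "dim (range ((*v) ?P)) = dim (UNIV :: (real ^ 'k) set)"
      by (intro dim_image_eq) auto
    then show "card B = CARD('k)" using card_orthonormal_basis[OF B(1)] B(2) by simp
    fix u assume u: "u \<in> B"
    have "red_laplacian a C = P' ** laplacian a ** ?P"
      by (simp only: red_laplacian_def P'_def Let_def)
    then have "red_laplacian a C *v (P' *v u) = P' *v (laplacian a *v (?P *v (P' *v u)))"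
      by (simp only: matrix_vector_mul_assoc matrix_mul_assoc)
    then show "red_laplacian a C *v (P' *v u) = ev u *\<^sub>R (P' *v u)"
      using u by (simp add: PP' span_base eig matrix_vector_mult_scaleR)
  qed
qed

text \<open>The sum is the squared length of the orthogonal projection of a unit vector onto the vectors
  that are constant on cells. This projection is the normalized indicator \<open>w\<close> of the cell.\<close>

lemma sum_projection_unit_vector:
  fixes C :: "'k::finite \<Rightarrow> 'v::finite set"
  assumes C: "graph_partition C" and i: "i \<in> C p"
    and B: "orthonormal B" "span B = range ((*v) (char_matrix C))"
  shows "(\<Sum>u\<in>B. (u \<bullet> axis i 1)\<^sup>2) = 1 / real (card (C p))"
proof -
  let ?P = "char_matrix C"
  define w where "w = ?P *v axis p (1 / real (card (C p)))"
  have w: "w $ j = (if j \<in> C p then 1 / real (card (C p)) else 0)" for j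
  proof -
    have "w $ j = (\<Sum>q\<in>UNIV. if q = p then ?P $ j $ p * (1 / real (card (C p))) else 0)"
      unfolding w_def matrix_vector_mult_def axis_def vec_lambda_beta by (intro sum.cong) auto
    then show ?thesis by (simp add: char_matrix_def)
  qed
  have pos: "card (C p) > 0" using i by (auto simp: card_gt_0_iff)
  have "u \<bullet> axis i 1 = u \<bullet> w" if "u \<in> B" for u
  proof -
    have "u \<in> range ((*v) ?P)" using span_base[OF that] unfolding B(2) .
    then obtain y where y: "u = ?P *v y" by (rule rangeE)
    have "u $ j = y $ p" if "j \<in> C p" for j
      using char_matrix_mult[OF C that] by (simp add: y)
    then have "u \<bullet> w = (\<Sum>j\<in>C p. y $ p * (1 / real (card (C p))))"
      by (simp add: inner_vec_def w if_distrib sum.If_cases cong: if_cong)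
    also have "\<dots> = y $ p" using pos by (simp add: card_gt_0_iff)
    also have "\<dots> = u \<bullet> axis i 1" using char_matrix_mult[OF C i, of y] by (simp add: y inner_axis)
    finally show ?thesis by simp
  qed
  then have "(\<Sum>u\<in>B. (u \<bullet> axis i 1)\<^sup>2) = (\<Sum>u\<in>B. (u \<bullet> w)\<^sup>2)" by simp
  also have "\<dots> = (norm w)\<^sup>2"
    using B by (intro parseval) (auto simp: w_def)
  also have "\<dots> = (\<Sum>j\<in>C p. (1 / real (card (C p)))\<^sup>2)"
    unfolding power2_norm_eq_inner inner_vec_def w
    by (simp add: if_distrib if_distribR sum.If_cases power2_eq_square cong: if_cong)
  also have "\<dots> = 1 / real (card (C p))" using pos by (simp add: power2_eq_square)
  finally show ?thesis .
qed

text \<open>Vectors in the kernel are constant, so they do not distinguish a unit vector from the constant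
  vector \<open>e\<close> with the same mean, to which Bessel's inequality applies.\<close>

lemma sum_kernel_unit_vector:
  fixes a :: "real ^ 'v ^ 'v"
  assumes a: "weighted_graph a" "graph_connected a" and U: "orthonormal U" "span U = UNIV"
  shows "(\<Sum>u\<in>{u \<in> U. laplacian a *v u = 0}. (u \<bullet> axis i 1)\<^sup>2) \<le> 1 / real CARD('v)"
proof -
  let ?N = "real CARD('v)"
  define e where "e = ((\<chi> j. 1 / ?N) :: real ^ 'v)"
  have "u \<bullet> axis i 1 = u \<bullet> e" if "laplacian a *v u = 0" for u
  proof -
    have "u $ j = u $ i" for j using laplacian_kernel[OF a that] .
    then have "u \<bullet> e = (\<Sum>j\<in>(UNIV :: 'v set). u $ i * (1 / ?N))"
      unfolding inner_vec_def e_def by (intro sum.cong) auto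
    then show ?thesis by (simp add: inner_axis)
  qed
  then have "(\<Sum>u\<in>{u \<in> U. laplacian a *v u = 0}. (u \<bullet> axis i 1)\<^sup>2) =
      (\<Sum>u\<in>{u \<in> U. laplacian a *v u = 0}. (u \<bullet> e)\<^sup>2)" by simp
  also have "\<dots> \<le> (\<Sum>u\<in>U. (u \<bullet> e)\<^sup>2)"
    using U(1) by (intro sum_mono2) (auto simp: orthonormal_def)
  also have "\<dots> = (norm e)\<^sup>2" using U by (intro parseval) auto
  also have "\<dots> = 1 / ?N"
    unfolding power2_norm_eq_inner inner_vec_def by (simp add: e_def)
  finally show ?thesis .
qed

section \<open>The error bounds\<close>

theorem theorem9:
  fixes a :: "real ^ 'v::finite ^ 'v"
    and v :: "'m::finite \<Rightarrow> 'v"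
    and C :: "'k::finite \<Rightarrow> 'v set"
    and c :: "'m \<Rightarrow> 'k"
    and A B :: "real ^ 'n::finite ^ 'n"
    and E :: "real ^ 'r::finite ^ 'n"
  assumes "weighted_graph a" and "graph_connected a"
    and "inj v"
    and "synchronized a A B"
    and "graph_partition C" and "almost_equitable a C"
    and "\<And>i. v i \<in> C (c i)"
  shows "(h2_norm (\<lambda>s. network_tf a v A B E s - reduced_tf a v C A B E s))\<^sup>2
      \<le> (S_max a C A B E)\<^sup>2 * (\<Sum>i\<in>UNIV. 1 - 1 / real (card (C (c i))))
    \<and> ((h2_norm (network_tf a v A B E))\<^sup>2 \<noteq> 0 \<and> (S_min a A B E)\<^sup>2 \<noteq> 0 \<and>
      real CARD('m) * (1 - 1 / real CARD('v)) \<noteq> 0 \<longrightarrow>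
      (h2_norm (\<lambda>s. network_tf a v A B E s - reduced_tf a v C A B E s))\<^sup>2
        / (h2_norm (network_tf a v A B E))\<^sup>2
      \<le> (S_max a C A B E)\<^sup>2 / (S_min a A B E)\<^sup>2
        * ((\<Sum>i\<in>UNIV. 1 - 1 / real (card (C (c i))))
            / (real CARD('m) * (1 - 1 / real CARD('v)))))"
proof -
  note a = assms(1,2) and C = assms(5)
  let ?L = "laplacian a" and ?P = "char_matrix C" and ?M = "leader_matrix v"
  let ?Lh = "red_laplacian a C" and ?Mh = "red_leader_matrix v C"
  have LP: "?L ** ?P = ?P ** ?Lh" using almost_equitable_quotient assms by blast
  have S: "subspace (range ((*v) ?P))" by (intro linear_subspace_image) auto
  have "?L *v x \<in> range ((*v) ?P)" if "x \<in> range ((*v) ?P)" for x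
    using that LP by (auto simp: matrix_vector_mul_assoc) (metis matrix_vector_mul_assoc rangeI)
  then obtain B1 B2 where U: "orthonormal (B1 \<union> B2)" "span (B1 \<union> B2) = UNIV" and disj: "B1 \<inter> B2 = {}"
    and B1: "span B1 = range ((*v) ?P)" and perp: "\<And>u x. u \<in> B2 \<Longrightarrow> x \<in> range ((*v) ?P) \<Longrightarrow> u \<bullet> x = 0"
    and eig0: "\<And>u. u \<in> B1 \<union> B2 \<Longrightarrow> ?L *v u = ((?L *v u) \<bullet> u) *\<^sub>R u"
    using adapted_eigenbasis[OF laplacian_symmetric[OF a(1)] S] by metis
  define U where "U = B1 \<union> B2"
  define ev where "ev u = (?L *v u) \<bullet> u" for u
  define J where "J l = (h2_norm (aux_tf A B E l))\<^sup>2" for l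
  define w where "w u = (\<Sum>j\<in>UNIV. (u \<bullet> axis (v j) 1)\<^sup>2)" for u :: "real ^ 'v"
  note U = U[folded U_def]
  have eig: "?L *v u = ev u *\<^sub>R u" if "u \<in> U" for u using eig0 that by (simp add: U_def ev_def)
  have fin: "finite U" "finite B1" "finite B2" using U(1) by (auto simp: orthonormal_def U_def)
  have oB1: "orthonormal B1" using U(1) by (auto simp: orthonormal_def U_def pairwise_def)
  have nz: "u \<noteq> 0" if "u \<in> U" for u using U(1) that by (auto simp: orthonormal_def)
  have ker: "?L *v u = 0 \<longleftrightarrow> ev u = 0" if "u \<in> U" for u using eig[OF that] nz[OF that] by auto
  have hur: "hurwitz (A - ev u *\<^sub>R B)" if "u \<in> U" "ev u \<noteq> 0" for u
    using synchronized_imp_hurwitz[OF a(1) assms(4) eig[OF that(1)] nz[OF that(1)] that(2)] .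
  have w0: "w u \<ge> 0" for u by (simp add: w_def sum_nonneg)
  have h0: "h2_norm (aux_tf A B E (ev u)) \<ge> 0" if "u \<in> U" "ev u \<noteq> 0" for u
    using h2_norm_sq_transfer_function(2)[OF hur[OF that], of E "mat (ev u)"]
    by (simp add: aux_tf_def[abs_def])
  \<comment> \<open>The kernel of the Laplacian consists of constant vectors, which are constant on cells and
    therefore orthogonal to \<open>B2\<close>.\<close>
  have ev2: "ev u \<noteq> 0" if "u \<in> B2" for u
  proof
    assume "ev u = 0"
    then have "?L *v u = 0" using ker that by (simp add: U_def)
    then have "u = (\<chi> i. u $ undefined)" using laplacian_kernel[OF a] by (simp add: vec_eq_iff)
    then have "u = ?P *v (\<chi> p. u $ undefined)" by (simp add: char_matrix_const[OF C])
    then have "u \<bullet> u = 0" using perp[OF that] by blast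
    with nz[of u] that show False by (simp add: U_def)
  qed
  have colM: "column j ?M = axis (v j) 1" for j
    by (simp add: column_def leader_matrix_def axis_def)

  have spec: "spectrum ?L = image_mset ev (mset_set U)"
    by (rule spectrum_orthonormal_eigenbasis[OF U eig])
  \<comment> \<open>Removing the eigenvalues of \<open>B1\<close> with multiplicity leaves exactly those of \<open>B2\<close>, even when
    both bases share an eigenvalue.\<close>
  have "spectrum ?Lh = image_mset ev (mset_set B1)"
    by (rule spectrum_red_laplacian[OF C oB1 B1]) (simp add: eig U_def)
  then have D: "set_mset (spectrum ?L - spectrum ?Lh) = ev ` B2"
    using spec fin disj by (simp add: U_def mset_set_Union)
  have Smax: "J (ev u) \<le> (S_max a C A B E)\<^sup>2" if "u \<in> B2" for u
  proof -
    have "h2_norm (aux_tf A B E (ev u)) \<le> S_max a C A B E"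
      unfolding S_max_def Let_def D using that fin by (auto intro!: Max_ge)
    then show ?thesis unfolding J_def using h0[of u] ev2[OF that] that
      by (intro power_mono) (auto simp: U_def)
  qed
  have Smin: "(S_min a A B E)\<^sup>2 \<le> J (ev u)" if "u \<in> U" "ev u \<noteq> 0" for u
  proof -
    have set: "set_mset (spectrum ?L) - {0} = ev ` {u \<in> U. ev u \<noteq> 0}" using spec fin by auto
    have "S_min a A B E \<le> h2_norm (aux_tf A B E (ev u))"
      unfolding S_min_def set using that fin by (intro Min_le) auto
    moreover have "S_min a A B E \<ge> 0"
      unfolding S_min_def set using that fin h0 by (subst Min_ge_iff) auto
    ultimately show ?thesis unfolding J_def by (intro power_mono)
  qed

  have normS: "(h2_norm (network_tf a v A B E))\<^sup>2 = (\<Sum>u\<in>{u \<in> U. ev u \<noteq> 0}. w u * J (ev u))"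
    using network_h2_norm[OF U eig hur, of "{}" "network_tf a v A B E" ?M E]
    by (simp add: network_tf_def[abs_def] colM w_def J_def)

  \<comment> \<open>Off the eigenvalues of both networks, the error is a network with a modified input matrix.\<close>
  define Z where "Z = {s. \<not> invertible (mat s - cmat (network_matrix ?L A B))} \<union>
    {s. \<not> invertible (mat s - cmat (network_matrix ?Lh A B))}"
  have "finite Z" by (simp add: Z_def finite_not_invertible_resolvent)
  have err: "network_tf a v A B E s - reduced_tf a v C A B E s =
    transfer_function (network_matrix ?L A B) (kron (?M - ?P ** ?Mh) E) (kron ?L (mat 1)) s"
    if "s \<notin> Z" for s
    using that reduced_transfer_function[OF LP, of s A B ?Mh E]
    by (simp add: Z_def network_tf_def reduced_tf_def transfer_function_diff_input kron_diff_left)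
  \<comment> \<open>The columns of \<open>P Mh\<close> are the orthogonal projections of those of \<open>M\<close> onto the range of \<open>P\<close>,
    so the residual does not excite \<open>B1\<close> and excites \<open>B2\<close> like \<open>M\<close> itself.\<close>
  have col1: "u \<bullet> column j (?M - ?P ** ?Mh) = 0" if u: "u \<in> B1" for u j
  proof -
    have "transpose ?P ** (?P ** ?Mh) = transpose ?P ** ?M"
      using matrix_inv_mult(1)[OF invertible_gram_char_matrix[OF C]]
      by (simp add: red_leader_matrix_def Let_def matrix_mul_assoc)
    then have "transpose ?P ** (?M - ?P ** ?Mh) = 0" by (simp add: matrix_mul_diff_right)
    then have "transpose ?P *v column j (?M - ?P ** ?Mh) = 0"
      by (simp add: vec_eq_iff matrix_vector_mult_def matrix_matrix_mult_def column_def)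
    moreover have "u \<in> range ((*v) ?P)" using span_base[OF u] unfolding B1 .
    then obtain y where "u = ?P *v y" by (rule rangeE)
    ultimately show ?thesis
      by (simp only: inner_commute[of "?P *v y"] dot_lmul_matrix[symmetric] transpose_matrix_vector
          inner_zero_left)
  qed
  have col2: "u \<bullet> column j (?M - ?P ** ?Mh) = u \<bullet> axis (v j) 1" if u: "u \<in> B2" for u j
  proof -
    have "column j (?M - ?P ** ?Mh) = column j ?M - ?P *v column j ?Mh"
      by (simp add: vec_eq_iff matrix_vector_mult_def matrix_matrix_mult_def column_def)
    then show ?thesis using perp[OF u] by (simp add: inner_diff_right colM)
  qed
  have "(h2_norm (\<lambda>s. network_tf a v A B E s - reduced_tf a v C A B E s))\<^sup>2 =
    (\<Sum>u\<in>{u \<in> U. ev u \<noteq> 0}. (\<Sum>j\<in>UNIV. (u \<bullet> column j (?M - ?P ** ?Mh))\<^sup>2) * J (ev u))"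
    unfolding J_def by (rule network_h2_norm[OF U eig hur \<open>finite Z\<close> err])
  also have "\<dots> = (\<Sum>u\<in>B2. w u * J (ev u))"
    using fin ev2 by (intro sum.mono_neutral_cong_right) (auto simp: U_def col1 col2 w_def)
  finally have normE: "(h2_norm (\<lambda>s. network_tf a v A B E s - reduced_tf a v C A B E s))\<^sup>2 =
    (\<Sum>u\<in>B2. w u * J (ev u))" .

  have unit: "(\<Sum>u\<in>U. (u \<bullet> axis i 1)\<^sup>2) = 1" for i
    using parseval[OF U(1), of "axis i 1"] U(2) by simp
  have "(\<Sum>u\<in>B2. w u) = (\<Sum>j\<in>UNIV. \<Sum>u\<in>B2. (u \<bullet> axis (v j) 1)\<^sup>2)"
    unfolding w_def by (rule sum.swap)
  also have "\<dots> = (\<Sum>j\<in>UNIV. 1 - 1 / real (card (C (c j))))"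
  proof (intro sum.cong refl)
    fix j
    show "(\<Sum>u\<in>B2. (u \<bullet> axis (v j) 1)\<^sup>2) = 1 - 1 / real (card (C (c j)))"
      using unit[of "v j"] sum_projection_unit_vector[OF C assms(7) oB1 B1, of j] fin disj
      by (simp add: U_def sum.union_disjoint)
  qed
  finally have sumB2: "(\<Sum>u\<in>B2. w u) = (\<Sum>j\<in>UNIV. 1 - 1 / real (card (C (c j))))" .
  have "(\<Sum>u\<in>B2. w u * J (ev u)) \<le> (\<Sum>u\<in>B2. w u * (S_max a C A B E)\<^sup>2)"
    by (intro sum_mono mult_left_mono Smax w0)
  then have upper: "(h2_norm (\<lambda>s. network_tf a v A B E s - reduced_tf a v C A B E s))\<^sup>2
      \<le> (S_max a C A B E)\<^sup>2 * (\<Sum>i\<in>UNIV. 1 - 1 / real (card (C (c i))))"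
    unfolding normE sumB2[symmetric] by (simp add: sum_distrib_right[symmetric] mult.commute)

  have "(\<Sum>u\<in>{u \<in> U. ev u \<noteq> 0}. w u) = (\<Sum>j\<in>UNIV. \<Sum>u\<in>{u \<in> U. ev u \<noteq> 0}. (u \<bullet> axis (v j) 1)\<^sup>2)"
    unfolding w_def by (rule sum.swap)
  also have "\<dots> \<ge> (\<Sum>j\<in>(UNIV :: 'm set). 1 - 1 / real CARD('v))"
  proof (intro sum_mono)
    fix j
    have "{u \<in> U. ?L *v u = 0} = U - {u \<in> U. ev u \<noteq> 0}" using ker by auto
    then show "1 - 1 / real CARD('v) \<le> (\<Sum>u\<in>{u \<in> U. ev u \<noteq> 0}. (u \<bullet> axis (v j) 1)\<^sup>2)"
      using unit[of "v j"] sum_kernel_unit_vector[OF a U, of "v j"] fin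
      by (simp add: sum_diff)
  qed
  finally have sumU: "real CARD('m) * (1 - 1 / real CARD('v)) \<le> (\<Sum>u\<in>{u \<in> U. ev u \<noteq> 0}. w u)"
    by simp
  have "(S_min a A B E)\<^sup>2 * (real CARD('m) * (1 - 1 / real CARD('v))) \<le>
      (S_min a A B E)\<^sup>2 * (\<Sum>u\<in>{u \<in> U. ev u \<noteq> 0}. w u)"
    using sumU by (intro mult_left_mono) auto
  also have "\<dots> \<le> (\<Sum>u\<in>{u \<in> U. ev u \<noteq> 0}. w u * J (ev u))"
    unfolding sum_distrib_left by (intro sum_mono) (use Smin w0 in \<open>auto simp: mult.commute intro: mult_left_mono\<close>)
  finally have lower: "(S_min a A B E)\<^sup>2 * (real CARD('m) * (1 - 1 / real CARD('v)))
      \<le> (h2_norm (network_tf a v A B E))\<^sup>2"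
    unfolding normS .
  show ?thesis
  proof (intro conjI impI upper, elim conjE)
    assume ne: "(S_min a A B E)\<^sup>2 \<noteq> 0" "real CARD('m) * (1 - 1 / real CARD('v)) \<noteq> 0"
    have "real CARD('m) * (1 - 1 / real CARD('v)) \<ge> 0" by simp
    with ne have pos: "(S_min a A B E)\<^sup>2 * (real CARD('m) * (1 - 1 / real CARD('v))) > 0"
      by (metis less_le mult_pos_pos zero_le_power2)
    show "(h2_norm (\<lambda>s. network_tf a v A B E s - reduced_tf a v C A B E s))\<^sup>2
        / (h2_norm (network_tf a v A B E))\<^sup>2
      \<le> (S_max a C A B E)\<^sup>2 / (S_min a A B E)\<^sup>2
        * ((\<Sum>i\<in>UNIV. 1 - 1 / real (card (C (c i))))
            / (real CARD('m) * (1 - 1 / real CARD('v))))"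
      unfolding times_divide_times_eq
      by (rule frac_le[OF _ upper pos lower]) (rule order_trans[OF zero_le_power2 upper])
  qed
qed

end
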